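(* Let $\varepsilon=\pm1$, $b\in\mathbb{R}$ with $\varepsilon b>0$, $a\in\mathbb{C}$, and let $(u(\tau),\varphi(\tau))$ be a solution of $$u''=\frac{(u')^2}{u}-\frac{u'}{\tau}+\frac1\tau\left(-8\varepsilon u^2+2ab\right)+\frac{b^2}{u},\qquad \varphi'(\tau)=\frac{2a}{\tau}+\frac{b}{u(\tau)},$$ corresponding to monodromy data with $g_{11}g_{12}g_{21}g_{22}\neq0$ and $|\mathrm{Re}(\tilde\nu+1)|<1/6$, where $\tilde\nu+1:=\frac{\mathrm{i}}{2\pi}\ln(g_{11}g_{22})$ (see context). Define $\mathrm{E}_\varphi(\tau)$ by $$\varphi(\tau)=3(\varepsilon b)^{1/3}\tau^{2/3}+2a\ln(\tau^{2/3})-a\ln\left((\varepsilon b)^{1/3}/4\right)+\pi-2\pi(\tilde\nu+1)+\mathrm{i}\ln(g_{11}^2)-2\mathrm{i}(\tilde\nu+1)\ln(2+\sqrt3)+\mathrm{E}_\varphi(\tau),$$ where the branch of $\ln(g_{11}^2)$ is such that $\mathrm{E}_\varphi(\tau)=o(\tau^{-\delta})$ as $\tau\to+\infty$ for some $\delta>0$. Then $$\mathrm{E}_\varphi(\tau)\underset{\tau\to+\infty}{=}\frac{2\sqrt{\tilde\nu+1}\,\mathrm{e}^{-3\pi\mathrm{i}/4}}{3^{3/4}(\varepsilon b)^{1/6}\tau^{1/3}}\sinh\big(\mathrm{i}\theta(\tau)+(\tilde\nu+1)\ln\theta(\tau)+z\big)+\mathcal{O}\left(\frac{\mathrm{e}^{\pm2\mathrm{i}\theta(\tau)}}{\tau^{\frac23(1-2|\mathrm{Re}(\tilde\nu+1)|)}}\right)+\mathcal{O}\left(\frac1{\tau^{2/3}}\right),$$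 where $\theta(\tau)=3^{3/2}(\varepsilon b)^{1/3}\tau^{2/3}$ and $$z=\frac{\ln2\pi}{2}+\frac{\pi\mathrm{i}}2-\frac{3\pi\mathrm{i}}2(\tilde\nu+1)+\mathrm{i}a\ln(2+\sqrt3)+(\tilde\nu+1)\ln12-\ln\left(g_{11}g_{12}\sqrt{\tilde\nu+1}\,\Gamma(\tilde\nu+1)\right).$$
   Context: The complex numbers $g_{11},g_{12},g_{21},g_{22}$ (with $g_{11}g_{22}-g_{12}g_{21}=1$) are part of the monodromy data of the associated isomonodromy system. The correspondence with $(u,\varphi)$ is expressed by the known large-$\tau$ asymptotics: for data satisfying the stated conditions, for some $\delta>0$, as $\tau\to+\infty$ along the positive semi-axis, $$u(\tau)=\frac{\varepsilon(\varepsilon b)^{2/3}}2\tau^{1/3}\left(1+\frac{2\sqrt{\tilde\nu+1}\,\mathrm{e}^{3\pi\mathrm{i}/4}}{3^{1/4}(\varepsilon b)^{1/6}\tau^{1/3}}\cosh\big(\mathrm{i}\theta(\tau)+(\tilde\nu+1)\ln\theta(\tau)+z+o(\tau^{-\delta})\big)\right),$$ and $\varphi$ has the asymptotics displayed in the claim with $\mathrm{E}_\varphi(\tau)=o(\tau^{-\delta})$ ($\varphi$ being defined modulo $2\pi$). The same branch of $\sqrt{\tilde\nu+1}$ is used throughout. It is also known (Shimomura) that such $u$ has a complete asymptotic expansion $$u(\tau)=\frac{\varepsilon(\varepsilon b)^{2/3}}{2}\tau^{1/3}\left(1+\sum_{k=1}^\infty\tau^{-k/3}\sum_{j=-k}^{k}a_{k,j}w^j\right),\qquad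 w=\tau^{\frac23(\tilde\nu+1)}\mathrm{e}^{\mathrm{i}\theta(\tau)},$$ with constant coefficients $a_{k,j}$, where $a_{1,0}=0$ and $a_{1,\pm1}=\frac{\sqrt{\tilde\nu+1}\,\mathrm{e}^{3\pi\mathrm{i}/4}}{3^{1/4}(\varepsilon b)^{1/6}}\mathrm{e}^{\pm\left((\tilde\nu+1)\ln(3^{3/2}(\varepsilon b)^{1/3})+z\right)}$. The notation $\mathcal{O}(\mathrm{e}^{\pm2\mathrm{i}\theta}/\tau^{\kappa})$ stands for the sum of the two error terms with the two signs (for $\tau>0$ both exponentials have modulus one). Roots and logarithms of positive numbers are positive, respectively real. *)

theory Defs
  imports "HOL-Analysis.Analysis" "HOL-Library.Landau_Symbols"
begin

text \<open>
  Solutions on a ray \<open>(T, \<infinity>)\<close> of the positive semi-axis, with complex values.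
  The requirement \<open>u \<tau> \<noteq> 0\<close> keeps the totalised division from giving the equations a spurious
  meaning at zeros of \<open>u\<close>.
\<close>

definition dp3_solution ::
  "real \<Rightarrow> real \<Rightarrow> complex \<Rightarrow> real \<Rightarrow> (real \<Rightarrow> complex) \<Rightarrow> (real \<Rightarrow> complex) \<Rightarrow> bool" where
  "dp3_solution \<epsilon> b a T u \<phi> \<longleftrightarrow>
     (\<exists>u'. \<forall>\<tau>>T. u \<tau> \<noteq> 0 \<and>
        (u has_vector_derivative u' \<tau>) (at \<tau>) \<and>
        (u' has_vector_derivative
           ((u' \<tau>)\<^sup>2 / u \<tau> - u' \<tau> / of_real \<tau>
            + 1 / of_real \<tau> * (- 8 * of_real \<epsilon> * (u \<tau>)\<^sup>2 + 2 * a * of_real b)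
            + of_real (b\<^sup>2) / u \<tau>)) (at \<tau>) \<and>
        (\<phi> has_vector_derivative (2 * a / of_real \<tau> + of_real b / u \<tau>)) (at \<tau>))"

definition theta :: "real \<Rightarrow> real \<Rightarrow> real \<Rightarrow> real" where
  "theta \<epsilon> b \<tau> = 3 powr (3/2) * (\<epsilon> * b) powr (1/3) * \<tau> powr (2/3)"

definition u_lead :: "real \<Rightarrow> real \<Rightarrow> real \<Rightarrow> real" where
  "u_lead \<epsilon> b \<tau> = \<epsilon> * (\<epsilon> * b) powr (2/3) / 2 * \<tau> powr (1/3)"

text \<open>
  In what follows \<open>\<nu>\<close> stands for the number traditionally written as \<open>\<nu>\<close>-tilde \<open>+ 1\<close>,
  and \<open>s\<close> for the chosen branch of its square root.
\<close>

definition u_asymptotics ::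
  "real \<Rightarrow> real \<Rightarrow> complex \<Rightarrow> complex \<Rightarrow> complex \<Rightarrow> (real \<Rightarrow> complex) \<Rightarrow> bool" where
  "u_asymptotics \<epsilon> b \<nu> s z u \<longleftrightarrow>
     (\<exists>\<delta>>0. \<exists>r \<in> o[at_top](\<lambda>\<tau>. complex_of_real (\<tau> powr (-\<delta>))).
        \<forall>\<^sub>F \<tau> in at_top.
          u \<tau> = of_real (u_lead \<epsilon> b \<tau>) *
            (1 + 2 * s * exp (3 * pi * \<i> / 4)
                   / of_real (3 powr (1/4) * (\<epsilon> * b) powr (1/6) * \<tau> powr (1/3))
                 * cosh (\<i> * of_real (theta \<epsilon> b \<tau>) + \<nu> * of_real (ln (theta \<epsilon> b \<tau>)) + z + r \<tau>)))"

definition w_fun :: "real \<Rightarrow> real \<Rightarrow> complex \<Rightarrow> real \<Rightarrow> complex" where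
  "w_fun \<epsilon> b \<nu> \<tau> = of_real \<tau> powr (2/3 * \<nu>) * exp (\<i> * of_real (theta \<epsilon> b \<tau>))"

text \<open>
  Complete expansion of \<open>u\<close> in powers of \<open>\<tau>\<close> to the \<open>-1/3\<close> and of \<open>w\<close>.  As \<open>|w|\<close> is in general
  neither bounded nor bounded away from \<open>0\<close>, the remainder after the terms \<open>k \<le> N\<close> is
  measured by the possible size of the term \<open>k = N + 1\<close>, which contains \<open>w\<close> to all powers
  between \<open>-(N+1)\<close> and \<open>N+1\<close>.
\<close>

definition u_complete_expansion ::
  "real \<Rightarrow> real \<Rightarrow> complex \<Rightarrow> complex \<Rightarrow> complex \<Rightarrow> (real \<Rightarrow> complex) \<Rightarrow> bool" where
  "u_complete_expansion \<epsilon> b \<nu> s z u \<longleftrightarrow>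
     (\<exists>A :: nat \<Rightarrow> int \<Rightarrow> complex.
        A 1 0 = 0 \<and>
        (\<forall>\<sigma>\<in>{1, -1}. A 1 \<sigma> =
           s * exp (3 * pi * \<i> / 4) / of_real (3 powr (1/4) * (\<epsilon> * b) powr (1/6))
           * exp (of_int \<sigma> * (\<nu> * of_real (ln (3 powr (3/2) * (\<epsilon> * b) powr (1/3))) + z))) \<and>
        (\<forall>N. (\<lambda>\<tau>. u \<tau> / of_real (u_lead \<epsilon> b \<tau>)
                   - (1 + (\<Sum>k=1..N. of_real (\<tau> powr (- real k / 3)) *
                             (\<Sum>j=-int k..int k. A k j * w_fun \<epsilon> b \<nu> \<tau> powi j))))
             \<in> O[at_top](\<lambda>\<tau>. complex_of_real
                  (\<tau> powr (- real (N + 1) / 3) *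
                   (cmod (w_fun \<epsilon> b \<nu> \<tau>) ^ (N + 1) + inverse (cmod (w_fun \<epsilon> b \<nu> \<tau>)) ^ (N + 1))))))"

text \<open>Here \<open>l\<close> is the chosen branch of the logarithm of \<open>g\<^sub>1\<^sub>1\<close> squared.\<close>

definition E_phi ::
  "real \<Rightarrow> real \<Rightarrow> complex \<Rightarrow> complex \<Rightarrow> complex \<Rightarrow> (real \<Rightarrow> complex) \<Rightarrow> real \<Rightarrow> complex" where
  "E_phi \<epsilon> b a \<nu> l \<phi> \<tau> = \<phi> \<tau> -
     (of_real (3 * (\<epsilon> * b) powr (1/3) * \<tau> powr (2/3))
      + 2 * a * of_real (ln (\<tau> powr (2/3)))
      - a * of_real (ln ((\<epsilon> * b) powr (1/3) / 4))
      + of_real pi - 2 * of_real pi * \<nu> + \<i> * l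
      - 2 * \<i> * \<nu> * of_real (ln (2 + sqrt 3)))"

end

theory Submission
  imports Defs
begin

text \<open>
  Put \<open>t = ln \<tau>\<close>, \<open>\<beta> = (\<epsilon> b)\<^bsup>1/3\<^esup>\<close>, \<open>Z = u / u_lead\<close>, \<open>p = Ln Z\<close> and \<open>x = 1 / Z - 1\<close>.  In these variables the
  equations read \<open>p'' = 4 \<beta>\<^sup>2 e\<^bsup>4t/3\<^esup> (3 x + x\<^sup>3 Z) + 4 a \<beta> e\<^bsup>2t/3\<^esup> / Z\<close> and \<open>E' = 2 a / 3 + 2 \<beta> e\<^bsup>2t/3\<^esup> x\<close>, where
  \<open>E\<close> is the error term of the phase.  The nonlinearity \<open>1 / Z\<^sup>2 - Z = 3 x + x\<^sup>3 Z\<close> has no quadratic term in \<open>x\<close>,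
  so eliminating \<open>x\<close> gives \<open>E = e\<^bsup>-2t/3\<^esup> (p' + 2 p / 3) / (6 \<beta>) + R\<close> with \<open>R'\<close> a combination of \<open>e\<^bsup>-2t/3\<^esup> p\<close>, \<open>x\<close>
  and \<open>e\<^bsup>2t/3\<^esup> x\<^sup>3 Z\<close>.  The first two orders of the expansion of \<open>u\<close> show that \<open>R'\<close> is oscillatory up to
  \<open>O(e\<^bsup>-2ct\<^esup>)\<close>, where \<open>c = (1 - 2 |Re \<nu>|) / 3\<close>; since \<open>R\<close> vanishes at infinity, \<open>R = O(e\<^bsup>-2ct\<^esup>)\<close>.
  The expansion of \<open>u\<close> cannot be differentiated as it stands.  However, \<open>p\<close> differs from its first-order term
  by \<open>O(e\<^bsup>-2ct\<^esup>)\<close>, and by the equation the second derivatives differ by \<open>O(e\<^bsup>4t/3 - 2ct\<^esup>)\<close>, so interpolation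
  yields \<open>p'\<close> with the accuracy \<open>O(e\<^bsup>2t/3 - 2ct\<^esup>)\<close> that is needed.

  Below, \<open>mon \<omega> \<nu> k j\<close> is \<open>\<tau>\<^bsup>-k/3\<^esup> w\<^bsup>j\<^esup>\<close> as a function of \<open>t\<close>; it is \<open>O(e\<^bsup>-kct\<^esup>)\<close> for \<open>|j| \<le> k\<close>.
\<close>

section \<open>Calculus of exponential bounds in the variable \<open>t = ln \<tau>\<close>\<close>

abbreviation exp_bigo :: "real \<Rightarrow> (real \<Rightarrow> complex) \<Rightarrow> bool" where
  "exp_bigo r f \<equiv> f \<in> O[at_top](\<lambda>t. complex_of_real (exp (r * t)))"

lemma exp_bigo_iff:
  "exp_bigo r f \<longleftrightarrow> (\<exists>C t0. C > 0 \<and> t0 \<ge> 0 \<and> (\<forall>t\<ge>t0. cmod (f t) \<le> C * exp (r * t)))"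
proof
  assume "exp_bigo r f"
  then obtain C where C: "C > 0" "\<forall>\<^sub>F t in at_top. cmod (f t) \<le> C * cmod (complex_of_real (exp (r * t)))"
    by (auto elim: landau_o.bigE)
  then obtain t0 where "\<forall>t\<ge>t0. cmod (f t) \<le> C * exp (r * t)"
    by (auto simp: eventually_at_top_linorder)
  then show "\<exists>C t0. C > 0 \<and> t0 \<ge> 0 \<and> (\<forall>t\<ge>t0. cmod (f t) \<le> C * exp (r * t))"
    using C(1) by (intro exI[of _ C] exI[of _ "max t0 0"]) auto
next
  assume "\<exists>C t0. C > 0 \<and> t0 \<ge> 0 \<and> (\<forall>t\<ge>t0. cmod (f t) \<le> C * exp (r * t))"
  then obtain C t0 where "\<forall>t\<ge>t0. cmod (f t) \<le> C * exp (r * t)" by blast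
  then show "exp_bigo r f"
    by (intro bigoI[of _ C]) (auto simp: eventually_at_top_linorder)
qed

lemma exp_bigo_mono:
  assumes "exp_bigo r f" "r \<le> r'"
  shows "exp_bigo r' f"
proof -
  have "exp_bigo r' (\<lambda>t. complex_of_real (exp (r * t)))"
    using assms(2) by (intro bigoI[of _ 1] eventually_mono[OF eventually_ge_at_top[of 0]])
      (auto intro!: mult_right_mono)
  with assms(1) show ?thesis
    using landau_o.big_trans by blast
qed

lemma exp_bigo_mult:
  assumes "exp_bigo r f" "exp_bigo r' g" "r + r' \<le> r''"
  shows "exp_bigo r'' (\<lambda>t. f t * g t)"
proof -
  have "exp_bigo (r + r') (\<lambda>t. f t * g t)"
    using landau_o.big.mult[OF assms(1,2)] by (simp add: distrib_right exp_add)
  then show ?thesis using assms(3) by (rule exp_bigo_mono)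
qed

lemma exp_bigo_cmult:
  assumes "exp_bigo r f" shows "exp_bigo r (\<lambda>t. c * f t)"
  using assms by (cases "c = 0") auto

lemma exp_bigo_exp: "r \<le> r' \<Longrightarrow> exp_bigo r' (\<lambda>t. complex_of_real (exp (r * t)))"
  by (rule exp_bigo_mono[where r = r]) auto

lemma exp_bigo_tendsto_0:
  assumes "exp_bigo r f" "r < 0"
  shows "(f \<longlongrightarrow> 0) at_top"
proof -
  obtain C t0 where C: "\<forall>t\<ge>t0. cmod (f t) \<le> C * exp (r * t)"
    using assms(1) unfolding exp_bigo_iff by blast
  have "filterlim (\<lambda>t. r * t) at_bot at_top"
    using assms(2) by (simp add: filterlim_ident filterlim_tendsto_neg_mult_at_bot[OF tendsto_const])
  then have "((\<lambda>t. exp (r * t)) \<longlongrightarrow> 0) at_top"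
    by (rule filterlim_compose[OF exp_at_bot])
  then have "((\<lambda>t. C * exp (r * t)) \<longlongrightarrow> 0) at_top"
    by (rule tendsto_mult_right_zero)
  then show ?thesis
    by (rule Lim_null_comparison[rotated]) (use C in \<open>auto simp: eventually_at_top_linorder\<close>)
qed

section \<open>Transfer of exponential bounds between a function and its derivatives\<close>

text \<open>This is integration back from infinity: the increment from \<open>t\<close> to
  \<open>T\<close> is estimated by integrating the bound on \<open>f'\<close>, and letting
  \<open>T\<close> tend to infinity removes \<open>f T\<close>. Since \<open>r < 0\<close>, the
  exponential rate survives integration.\<close>

lemma exp_bigo_from_derivative:
  assumes deriv: "\<And>t. t \<ge> t0 \<Longrightarrow> (f has_vector_derivative f' t) (at t)"
    and f': "exp_bigo r f'" and r: "r < 0" and lim: "(f \<longlongrightarrow> 0) at_top"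
  shows "exp_bigo r f"
proof -
  obtain C t1 where C: "C > 0" "\<forall>t\<ge>t1. cmod (f' t) \<le> C * exp (r * t)"
    using f' unfolding exp_bigo_iff by blast
  define t2 where "t2 = max t0 t1"
  have bound: "cmod (f t) \<le> (C / - r) * exp (r * t)" if t: "t \<ge> t2" for t
  proof (rule tendsto_upperbound[of "\<lambda>T. cmod (f T - f t)" _ at_top])
    show "((\<lambda>T. cmod (f T - f t)) \<longlongrightarrow> cmod (f t)) at_top"
      using tendsto_norm[OF tendsto_diff[OF lim tendsto_const[of "f t"]]] by simp
    show "\<forall>\<^sub>F T in at_top. cmod (f T - f t) \<le> (C / - r) * exp (r * t)"
    proof (rule eventually_mono[OF eventually_gt_at_top[of t]])
      fix T assume T: "t < T"
      have "cmod (f T - f t) \<le> C / r * exp (r * T) - C / r * exp (r * t)"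
      proof (rule differentiable_bound_general[OF T, where f' = f' and \<phi>' = "\<lambda>s. C * exp (r * s)"])
        show "continuous_on {t..T} f"
        proof (intro continuous_at_imp_continuous_on ballI)
          fix s assume "s \<in> {t..T}"
          then have "(f has_vector_derivative f' s) (at s)" using deriv t by (simp add: t2_def)
          then show "isCont f s" by (rule has_vector_derivative_continuous)
        qed
        show "continuous_on {t..T} (\<lambda>s. C / r * exp (r * s))"
          by (intro continuous_intros)
        fix s assume s: "t < s" "s < T"
        show "(f has_vector_derivative f' s) (at s)"
          using deriv s t by (auto simp: t2_def)
        show "((\<lambda>s. C / r * exp (r * s)) has_vector_derivative C * exp (r * s)) (at s)"
          unfolding has_real_derivative_iff_has_vector_derivative[symmetric]
          using r by (auto intro!: derivative_eq_intros)
        show "cmod (f' s) \<le> C * exp (r * s)"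
          using C(2) s t by (auto simp: t2_def)
      qed
      also have "\<dots> \<le> (C / - r) * exp (r * t)"
        using C(1) r by (simp add: divide_le_0_iff mult_le_0_iff)
      finally show "cmod (f T - f t) \<le> (C / - r) * exp (r * t)" .
    qed
  qed auto
  show ?thesis
    by (rule bigoI[of _ "C / - r"]) (use bound in \<open>auto simp: eventually_at_top_linorder\<close>)
qed

lemma norm_increment_le:
  fixes f :: "real \<Rightarrow> 'a::real_normed_vector"
  assumes "a \<le> b" and "\<And>x. x \<in> {a..b} \<Longrightarrow> (f has_vector_derivative f' x) (at x)"
    and "\<And>x. x \<in> {a..b} \<Longrightarrow> norm (f' x) \<le> B"
  shows "norm (f b - f a) \<le> B * (b - a)"
proof (cases "a = b")
  case False
  have "norm (f b - f a) \<le> B * b - B * a"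
  proof (rule differentiable_bound_general[where f' = f' and \<phi>' = "\<lambda>_. B"])
    show "continuous_on {a..b} f"
      using assms(2) has_vector_derivative_continuous by (blast intro: continuous_at_imp_continuous_on)
    show "((\<lambda>x. B * x) has_vector_derivative B) (at x)" for x
      unfolding has_real_derivative_iff_has_vector_derivative[symmetric]
      by (auto intro!: derivative_eq_intros)
  qed (use assms False in \<open>auto intro!: continuous_intros\<close>)
  then show ?thesis by (simp add: algebra_simps)
qed simp

text \<open>A Landau--Kolmogorov interpolation, from Taylor's formula with step \<open>exp (- m t)\<close>.\<close>

lemma exp_bigo_interpolate:
  assumes d: "\<And>t. t \<ge> t0 \<Longrightarrow> (d has_vector_derivative d1 t) (at t)"
    and d1: "\<And>t. t \<ge> t0 \<Longrightarrow> (d1 has_vector_derivative d2 t) (at t)"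
    and O0: "exp_bigo r d" and O2: "exp_bigo (r + 2 * m) d2" and m: "m \<ge> 0"
  shows "exp_bigo (r + m) d1"
proof -
  obtain C t1 where C: "C > 0" "\<And>t. t\<ge>t1 \<Longrightarrow> cmod (d t) \<le> C * exp (r * t)"
    using O0 unfolding exp_bigo_iff by blast
  obtain D t2 where D: "D > 0" "\<And>t. t\<ge>t2 \<Longrightarrow> cmod (d2 t) \<le> D * exp ((r + 2 * m) * t)"
    using O2 unfolding exp_bigo_iff by blast
  define t3 where "t3 = max 0 (max t0 (max t1 t2))"
  define K where "K = exp \<bar>r\<bar>"
  define M where "M = exp \<bar>r + 2 * m\<bar>"
  \<comment> \<open>The bounds on \<open>d\<close> and \<open>d2\<close> are needed on a window of
    length at most 1 to the right of \<open>t\<close>. There an exponential changes only by a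
    bounded factor, so its value at \<open>t\<close> serves throughout.\<close>
  have near: "exp (k * s) \<le> exp \<bar>k\<bar> * exp (k * t)" if "t \<le> s" "s \<le> t + 1" for k s t :: real
  proof -
    have "k * (s - t) \<le> \<bar>k\<bar> * (s - t)"
      using that by (intro mult_right_mono) auto
    also have "\<dots> \<le> \<bar>k\<bar> * 1"
      using that by (intro mult_left_mono) auto
    finally have "k * (s - t) \<le> \<bar>k\<bar>" by simp
    then have "k * s \<le> \<bar>k\<bar> + k * t" by (simp add: right_diff_distrib)
    then have "exp (k * s) \<le> exp (\<bar>k\<bar> + k * t)" by simp
    then show ?thesis by (simp add: exp_add)
  qed
  have bound: "cmod (d1 t) \<le> (2 * C * K + D * M) * exp ((r + m) * t)" if t: "t \<ge> t3" for t
  proof -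
    \<comment> \<open>After division by \<open>h\<close>, the values of \<open>d\<close> contribute
      \<open>exp (r * t) / h\<close> and the second derivative contributes
      \<open>h * exp ((r + 2 * m) * t)\<close>. This \<open>h\<close> makes both equal to
      \<open>exp ((r + m) * t)\<close>.\<close>
    define h where "h = exp (- m * t)"
    have h: "h > 0" "h \<le> 1" using m t by (auto simp: h_def t3_def)
    have seg: "s \<ge> t0" "s \<ge> t1" "s \<ge> t2" "t \<le> s" "s \<le> t + 1" if "s \<in> {t..t+h}" for s
      using that t h by (auto simp: t3_def)
    define B where "B = D * M * exp ((r + 2 * m) * t)"
    have B0: "B \<ge> 0" using D(1) by (simp add: B_def M_def)
    have d2B: "cmod (d2 s) \<le> B" if s: "s \<in> {t..t+h}" for s
    proof -
      have "cmod (d2 s) \<le> D * exp ((r + 2 * m) * s)" by (rule D(2)[OF seg(3)[OF s]])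
      also have "\<dots> \<le> D * (M * exp ((r + 2 * m) * t))"
        using near[OF seg(4,5)[OF s]] D(1) unfolding M_def by (intro mult_left_mono) auto
      finally show ?thesis by (simp add: B_def)
    qed
    have dB: "cmod (d s) \<le> C * K * exp (r * t)" if s: "s \<in> {t..t+h}" for s
    proof -
      have "cmod (d s) \<le> C * exp (r * s)" by (rule C(2)[OF seg(2)[OF s]])
      also have "\<dots> \<le> C * (K * exp (r * t))"
        using near[OF seg(4,5)[OF s]] C(1) unfolding K_def by (intro mult_left_mono) auto
      finally show ?thesis by simp
    qed
    have d1B: "cmod (d1 s - d1 t) \<le> B * h" if s: "s \<in> {t..t+h}" for s
    proof -
      have "cmod (d1 s - d1 t) \<le> B * (s - t)"
      proof (rule norm_increment_le[where f' = d2])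
        fix x assume "x \<in> {t..s}"
        with s have x: "x \<in> {t..t+h}" by auto
        show "(d1 has_vector_derivative d2 x) (at x)" by (rule d1[OF seg(1)[OF x]])
        show "cmod (d2 x) \<le> B" by (rule d2B[OF x])
      qed (use s in auto)
      also have "\<dots> \<le> B * h" using B0 s by (intro mult_left_mono) auto
      finally show ?thesis .
    qed
    \<comment> \<open>Subtracting the tangent direction at \<open>t\<close> leaves a function of
      \<open>s\<close> with derivative \<open>d1 s - d1 t\<close>, so the increment of
      \<open>d\<close> equals \<open>h * d1 t\<close> up to \<open>B * h^2\<close>.\<close>
    have taylor: "cmod ((d (t + h) - of_real (t + h) * d1 t) - (d t - of_real t * d1 t)) \<le> B * h * (t + h - t)"
    proof (rule norm_increment_le[where f' = "\<lambda>s. d1 s - d1 t"])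
      fix x assume x: "x \<in> {t..t+h}"
      show "((\<lambda>s. d s - of_real s * d1 t) has_vector_derivative d1 x - d1 t) (at x)"
        by (auto intro!: derivative_eq_intros d[OF seg(1)[OF x]])
      show "cmod (d1 x - d1 t) \<le> B * h" by (rule d1B[OF x])
    qed (use h in auto)
    have "h * cmod (d1 t) = cmod (of_real h * d1 t)"
      using h by (simp add: norm_mult)
    also have "\<dots> = cmod (d (t + h) - d t -
        ((d (t + h) - of_real (t + h) * d1 t) - (d t - of_real t * d1 t)))"
      by (simp add: algebra_simps)
    also have "\<dots> \<le> cmod (d (t + h)) + cmod (d t) + B * h * h"
      using taylor norm_triangle_ineq4[of "d (t + h)" "d t"]
      by (intro order_trans[OF norm_triangle_ineq4]) simp
    also have "\<dots> \<le> 2 * C * K * exp (r * t) + B * h * h"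
      using dB[of "t + h"] dB[of t] h by simp
    also have "\<dots> = h * ((2 * C * K + D * M) * exp ((r + m) * t))"
      by (simp add: h_def B_def algebra_simps exp_add[symmetric])
    finally show ?thesis using h by simp
  qed
  show ?thesis
    by (rule bigoI[of _ "2 * C * K + D * M"]) (use bound in \<open>auto simp: eventually_at_top_linorder\<close>)
qed

section \<open>Functions with a small primitive\<close>

text \<open>An oscillating \<open>f\<close> may be much larger than its primitive. The definition
  records the size of an approximate primitive \<open>g\<close> without using integrals; the defect
  \<open>g' - f\<close> is allowed the same size because, for \<open>r < 0\<close>, integrating it
  from infinity costs only a constant.\<close>

definition primitive_bigo :: "real \<Rightarrow> (real \<Rightarrow> complex) \<Rightarrow> bool" where
  "primitive_bigo r f \<longleftrightarrow>
     (\<exists>g g'. (\<forall>t. (g has_vector_derivative g' t) (at t)) \<and> exp_bigo r g \<and> exp_bigo r (\<lambda>t. g' t - f t))"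

lemma exp_bigo_imp_primitive_bigo: "exp_bigo r f \<Longrightarrow> primitive_bigo r f"
  unfolding primitive_bigo_def by (intro exI[of _ "\<lambda>_. 0"]) auto

lemma primitive_bigo_add:
  assumes "primitive_bigo r f1" "primitive_bigo r f2"
  shows "primitive_bigo r (\<lambda>t. f1 t + f2 t)"
proof -
  obtain g1 g1' g2 g2' where
    g: "\<And>t. (g1 has_vector_derivative g1' t) (at t)" "exp_bigo r g1" "exp_bigo r (\<lambda>t. g1' t - f1 t)"
       "\<And>t. (g2 has_vector_derivative g2' t) (at t)" "exp_bigo r g2" "exp_bigo r (\<lambda>t. g2' t - f2 t)"
    using assms unfolding primitive_bigo_def by blast
  have "exp_bigo r (\<lambda>t. (g1' t - f1 t) + (g2' t - f2 t))"
    using g(3,6) by (rule sum_in_bigo)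
  then have "exp_bigo r (\<lambda>t. g1' t + g2' t - (f1 t + f2 t))"
    by (simp add: algebra_simps)
  then show ?thesis
    unfolding primitive_bigo_def
    by (intro exI[of _ "\<lambda>t. g1 t + g2 t"] exI[of _ "\<lambda>t. g1' t + g2' t"])
      (use g in \<open>auto intro!: derivative_intros sum_in_bigo\<close>)
qed

lemma primitive_bigo_cmult:
  assumes "primitive_bigo r f"
  shows "primitive_bigo r (\<lambda>t. c * f t)"
proof -
  obtain g g' where
    g: "\<And>t. (g has_vector_derivative g' t) (at t)" "exp_bigo r g" "exp_bigo r (\<lambda>t. g' t - f t)"
    using assms unfolding primitive_bigo_def by blast
  have "exp_bigo r (\<lambda>t. c * g' t - c * f t)"
    using exp_bigo_cmult[OF g(3), of c] by (simp add: right_diff_distrib)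
  then show ?thesis
    unfolding primitive_bigo_def
    by (intro exI[of _ "\<lambda>t. c * g t"] exI[of _ "\<lambda>t. c * g' t"])
      (use g exp_bigo_cmult in \<open>auto intro!: derivative_intros\<close>)
qed

lemma primitive_bigo_sum:
  assumes "\<And>i. i \<in> I \<Longrightarrow> primitive_bigo r (f i)"
  shows "primitive_bigo r (\<lambda>t. \<Sum>i\<in>I. f i t)"
  using assms
proof (induction I rule: infinite_finite_induct)
  case (insert i I)
  then show ?case by (simp add: primitive_bigo_add)
qed (auto intro: exp_bigo_imp_primitive_bigo)

text \<open>The difference \<open>F - g\<close> vanishes at infinity and has the small derivative
  \<open>f - g'\<close>, so it is itself small.\<close>

lemma exp_bigo_from_primitive_bigo:
  assumes deriv: "\<And>t. t \<ge> t0 \<Longrightarrow> (F has_vector_derivative f t) (at t)"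
    and f: "primitive_bigo r f" and r: "r < 0" and lim: "(F \<longlongrightarrow> 0) at_top"
  shows "exp_bigo r F"
proof -
  obtain g g' where
    g: "\<And>t. (g has_vector_derivative g' t) (at t)" "exp_bigo r g" "exp_bigo r (\<lambda>t. g' t - f t)"
    using f unfolding primitive_bigo_def by blast
  have "exp_bigo r (\<lambda>t. F t - g t)"
  proof (rule exp_bigo_from_derivative)
    show "((\<lambda>t. F t - g t) has_vector_derivative f t - g' t) (at t)" if "t \<ge> t0" for t
      by (intro derivative_intros deriv that g)
    show "exp_bigo r (\<lambda>t. f t - g' t)"
      using g(3) by (subst landau_o.big.uminus_in_iff[symmetric]) simp
    show "((\<lambda>t. F t - g t) \<longlongrightarrow> 0) at_top"
      using tendsto_diff[OF lim exp_bigo_tendsto_0[OF g(2) r]] by simp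
  qed (use r in auto)
  from sum_in_bigo(1)[OF this g(2)] show ?thesis by simp
qed

lemma primitive_bigo_perturb:
  assumes "primitive_bigo r f" "exp_bigo r (\<lambda>t. h t - f t)"
  shows "primitive_bigo r h"
  using primitive_bigo_add[OF assms(1) exp_bigo_imp_primitive_bigo[OF assms(2)]] by simp

section \<open>Monomials of the expansion and their oscillatory integrals\<close>

definition mon :: "real \<Rightarrow> complex \<Rightarrow> nat \<Rightarrow> int \<Rightarrow> real \<Rightarrow> complex" where
  "mon \<omega> \<nu> k j t =
     exp (- of_nat k / 3 * of_real t
          + of_int j * (2 / 3 * \<nu> * of_real t + \<i> * of_real \<omega> * of_real (exp (2 / 3 * t))))"

lemma mon_mult: "mon \<omega> \<nu> k j t * mon \<omega> \<nu> l i t = mon \<omega> \<nu> (k + l) (j + i) t"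
  unfolding mon_def exp_add[symmetric]
  by (rule arg_cong[where f = exp]) (simp add: field_simps)

text \<open>A first-order monomial carries no factor \<open>exp (2 / 3 * t)\<close>. Reading it as
  that factor times a monomial of order 3 brings it into the form to which integration by parts
  against the phase applies.\<close>

lemma exp_times_mon: "of_real (exp (2 / 3 * t)) * mon \<omega> \<nu> 3 j t = mon \<omega> \<nu> 1 j t"
  unfolding mon_def exp_of_real[symmetric] exp_add[symmetric]
  by (rule arg_cong[where f = exp]) (simp add: field_simps)

lemma mon_has_vector_derivative:
  "(mon \<omega> \<nu> k j has_vector_derivative
     (- of_nat k / 3 + of_int j * (2 / 3 * \<nu> + \<i> * of_real \<omega> * (2 / 3 * of_real (exp (2 / 3 * t))))) *
     mon \<omega> \<nu> k j t) (at t)"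
proof -
  have "((\<lambda>t. - of_nat k / 3 * of_real t
      + of_int j * (2 / 3 * \<nu> * of_real t + \<i> * of_real \<omega> * of_real (exp (2 / 3 * t)))) has_vector_derivative
     (- of_nat k / 3 + of_int j * (2 / 3 * \<nu> + \<i> * of_real \<omega> * of_real (2 / 3 * exp (2 / 3 * t))))) (at t)"
    by (auto intro!: derivative_eq_intros simp: algebra_simps)
  from field_vector_diff_chain_at[OF this DERIV_exp] show ?thesis
    by (simp add: mon_def[abs_def] o_def)
qed

lemma cmod_mon: "cmod (mon \<omega> \<nu> k j t) = exp ((- real k / 3 + 2 / 3 * of_int j * Re \<nu>) * t)"
  unfolding mon_def norm_exp_eq_Re by (simp add: algebra_simps)

lemma exp_bigo_mon:
  assumes "\<bar>j\<bar> \<le> int k"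
  shows "exp_bigo (- real k * ((1 - 2 * \<bar>Re \<nu>\<bar>) / 3)) (mon \<omega> \<nu> k j)"
proof -
  have "of_int j * Re \<nu> \<le> \<bar>of_int j * Re \<nu>\<bar>" by simp
  also have "\<dots> \<le> real k * \<bar>Re \<nu>\<bar>"
    unfolding abs_mult using assms by (intro mult_right_mono) linarith+
  finally have "- real k / 3 + 2 / 3 * of_int j * Re \<nu> \<le> - real k * ((1 - 2 * \<bar>Re \<nu>\<bar>) / 3)"
    by (simp add: field_simps)
  then have "cmod (mon \<omega> \<nu> k j t) \<le> exp (- real k * ((1 - 2 * \<bar>Re \<nu>\<bar>) / 3) * t)" if "t \<ge> 0" for t
    unfolding cmod_mon exp_le_cancel_iff using that by (rule mult_right_mono)
  then show ?thesis
    by (intro bigoI[of _ 1] eventually_mono[OF eventually_ge_at_top[of 0]]) auto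
qed

text \<open>Integration by parts against the phase: the frequency of the monomial grows like
  \<open>exp (2 / 3 * t)\<close>, so integrating gains that factor back.\<close>

lemma primitive_bigo_mon:
  assumes j: "j \<noteq> 0" "\<bar>j\<bar> \<le> int k" and \<omega>: "\<omega> \<noteq> 0"
    and r: "- real k * ((1 - 2 * \<bar>Re \<nu>\<bar>) / 3) \<le> r"
  shows "primitive_bigo r (\<lambda>t. of_real (exp (2 / 3 * t)) * mon \<omega> \<nu> k j t)"
proof -
  define m where "m = \<i> * of_real \<omega> * (2 / 3) * of_int j"
  have m: "m \<noteq> 0" using j \<omega> by (simp add: m_def)
  define g' where "g' t = (1 / m) * ((- of_nat k / 3 + of_int j * (2 / 3 * \<nu> + \<i> * of_real \<omega> * (2 / 3 * of_real (exp (2 / 3 * t))))) *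
     mon \<omega> \<nu> k j t)" for t
  \<comment> \<open>Dividing by \<open>m\<close> normalises the fast part of the logarithmic
    derivative to \<open>exp (2 / 3 * t)\<close>. What is left over is a constant multiple of the
    monomial, with no growing factor.\<close>
  have eq: "g' t - of_real (exp (2 / 3 * t)) * mon \<omega> \<nu> k j t =
      ((- of_nat k / 3 + of_int j * (2 / 3 * \<nu>)) / m) * mon \<omega> \<nu> k j t" for t
  proof -
    have "g' t = (1 / m) * ((- of_nat k / 3 + of_int j * (2 / 3 * \<nu>)) + m * of_real (exp (2 / 3 * t))) * mon \<omega> \<nu> k j t"
      by (simp add: g'_def m_def algebra_simps)
    then show ?thesis using m by (simp add: field_simps)
  qed
  have O: "exp_bigo r (mon \<omega> \<nu> k j)"
    using exp_bigo_mono[OF exp_bigo_mon[OF j(2)] r] .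
  show ?thesis unfolding primitive_bigo_def
  proof (rule exI[of _ "\<lambda>t. (1 / m) * mon \<omega> \<nu> k j t"], rule exI[of _ g'], intro conjI allI)
    show "((\<lambda>t. (1 / m) * mon \<omega> \<nu> k j t) has_vector_derivative g' t) (at t)" for t
      unfolding g'_def by (intro has_vector_derivative_mult_right mon_has_vector_derivative)
  qed (use O in \<open>auto simp only: eq intro: exp_bigo_cmult\<close>)
qed

text \<open>The cube of the odd first-order term has no component of index \<open>0\<close>, so no resonance occurs.\<close>

lemma primitive_bigo_order_3:
  assumes \<omega>: "\<omega> \<noteq> 0" and V1: "\<And>t. V1 t = A * mon \<omega> \<nu> 1 1 t + B * mon \<omega> \<nu> 1 (-1) t"
    and r: "- 3 * ((1 - 2 * \<bar>Re \<nu>\<bar>) / 3) \<le> r"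
  shows "primitive_bigo r (\<lambda>t. of_real (exp (2 / 3 * t)) * V1 t ^ 3)"
proof -
  let ?m = "\<lambda>j t. of_real (exp (2 / 3 * t)) * mon \<omega> \<nu> 3 j t"
  have prod: "mon \<omega> \<nu> 3 3 t = mon \<omega> \<nu> 1 1 t ^ 3"
    "mon \<omega> \<nu> 3 1 t = mon \<omega> \<nu> 1 1 t ^ 2 * mon \<omega> \<nu> 1 (-1) t"
    "mon \<omega> \<nu> 3 (-1) t = mon \<omega> \<nu> 1 1 t * mon \<omega> \<nu> 1 (-1) t ^ 2"
    "mon \<omega> \<nu> 3 (-3) t = mon \<omega> \<nu> 1 (-1) t ^ 3" for t
    by (simp_all add: power2_eq_square power3_eq_cube mon_mult numeral_3_eq_3)
  have "of_real (exp (2 / 3 * t)) * V1 t ^ 3 =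
      (A ^ 3 * ?m 3 t + 3 * A\<^sup>2 * B * ?m 1 t) + (3 * A * B\<^sup>2 * ?m (-1) t + B ^ 3 * ?m (-3) t)" for t
    unfolding prod V1 by (simp add: power2_eq_square power3_eq_cube algebra_simps)
  then show ?thesis
    by (simp only:) (intro primitive_bigo_add primitive_bigo_cmult primitive_bigo_mon; use \<omega> r in simp)
qed

text \<open>Here resonance is possible, but \<open>exp (2 / 3 * t) * mon \<omega> \<nu> 4 0 t = exp (- 2 / 3 * t)\<close> is already small.\<close>

lemma primitive_bigo_order_4:
  assumes \<omega>: "\<omega> \<noteq> 0"
    and f: "\<And>t. f t = (\<Sum>j=-2..2. a j * mon \<omega> \<nu> 2 j t)" "\<And>t. g t = (\<Sum>j=-2..2. b j * mon \<omega> \<nu> 2 j t)"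
    and r: "- 4 * ((1 - 2 * \<bar>Re \<nu>\<bar>) / 3) \<le> r" "- 2 / 3 \<le> r"
  shows "primitive_bigo r (\<lambda>t. of_real (exp (2 / 3 * t)) * (f t * g t))"
proof -
  have mon4: "primitive_bigo r (\<lambda>t. of_real (exp (2 / 3 * t)) * mon \<omega> \<nu> 4 j t)" if "\<bar>j\<bar> \<le> 4" for j
  proof (cases "j = 0")
    case True
    have "of_real (exp (2 / 3 * t)) * mon \<omega> \<nu> 4 0 t = complex_of_real (exp ((- 2 / 3) * t))" for t
      by (simp add: mon_def exp_of_real[symmetric] exp_add[symmetric] algebra_simps)
    then show ?thesis using exp_bigo_exp[OF r(2)] True
      by (intro exp_bigo_imp_primitive_bigo) (simp only:)
  next
    case False
    then show ?thesis using that \<omega> r by (intro primitive_bigo_mon) auto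
  qed
  have "of_real (exp (2 / 3 * t)) * (f t * g t) =
      (\<Sum>i=-2..2. \<Sum>j=-2..2. (a i * b j) * (of_real (exp (2 / 3 * t)) * mon \<omega> \<nu> 4 (i + j) t))" for t
  proof -
    have "mon \<omega> \<nu> 4 (i + j) t = mon \<omega> \<nu> 2 i t * mon \<omega> \<nu> 2 j t" for i j
      by (simp add: mon_mult)
    then show ?thesis
      by (simp only: f sum_product) (simp add: sum_distrib_left mult_ac)
  qed
  then show ?thesis
    by (simp only:) (intro primitive_bigo_sum primitive_bigo_cmult mon4; auto)
qed

section \<open>Asymptotics of the phase in logarithmic time\<close>

lemma phase_asymptotics:
  fixes \<beta> c \<omega> t1 :: real and \<nu> A B a :: complex
    and Z V1 V2 p1 E :: "real \<Rightarrow> complex" and coeff :: "int \<Rightarrow> complex"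
  assumes \<beta>: "\<beta> > 0" and Re_nu: "\<bar>Re \<nu>\<bar> < 1/6" and c: "c = (1 - 2 * \<bar>Re \<nu>\<bar>) / 3"
    and \<omega>: "\<omega> = 3 * sqrt 3 * \<beta>"
    and V1: "\<And>t. V1 t = A * mon \<omega> \<nu> 1 1 t + B * mon \<omega> \<nu> 1 (-1) t"
    and V2: "\<And>t. V2 t = (\<Sum>j=-2..2. coeff j * mon \<omega> \<nu> 2 j t)"
    and Z: "exp_bigo (- 3 * c) (\<lambda>t. Z t - 1 - V1 t - V2 t)"
    and Z_deriv: "\<And>t. t \<ge> t1 \<Longrightarrow> (Z has_vector_derivative p1 t * Z t) (at t)"
    and p1_deriv: "\<And>t. t \<ge> t1 \<Longrightarrow> (p1 has_vector_derivative
        4 * of_real \<beta> ^ 2 * of_real (exp (2/3 * t)) ^ 2 * ((1 / Z t) ^ 2 - Z t)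
        + 4 * a * of_real \<beta> * of_real (exp (2/3 * t)) * (1 / Z t)) (at t)"
    and E_deriv: "\<And>t. t \<ge> t1 \<Longrightarrow> (E has_vector_derivative
        2 * a / 3 + 2 * of_real \<beta> * of_real (exp (2/3 * t)) * (1 / Z t - 1)) (at t)"
    and E_lim: "(E \<longlongrightarrow> 0) at_top"
  shows "exp_bigo (- 2 * c) (\<lambda>t. E t - \<i> / of_real (sqrt 3) * (A * mon \<omega> \<nu> 1 1 t - B * mon \<omega> \<nu> 1 (-1) t))"
proof -
  \<comment> \<open>The lower bound restates \<open>|Re \<nu>| < 1/6\<close>. It is equivalent to
    \<open>2/3 - 5 * c < - 2 * c\<close>, which allows the order-5 remainder of the cubic term to be
    multiplied by \<open>exp (2/3 * t)\<close>. The upper bound makes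
    \<open>exp (- 2/3 * t)\<close>, the size of the resonant terms, admissible.\<close>
  have c_bounds: "2/9 < c" "c \<le> 1/3" using Re_nu c by auto
  have \<omega>0: "\<omega> \<noteq> 0" using \<beta> \<omega> by simp
  \<comment> \<open>Hence \<open>(2/3 * \<omega>)^2 = 12 * \<beta>^2\<close>, the coefficient in the
    linearised equation \<open>p'' = - 12 \<beta>^2 e^(4t/3) p\<close>: to leading order the
    first-order term solves it.\<close>
  have \<omega>_sq: "complex_of_real \<omega> ^ 2 = 27 * of_real \<beta> ^ 2"
  proof -
    have "\<omega> ^ 2 = 27 * \<beta> ^ 2" by (simp add: \<omega> power_mult_distrib)
    then show ?thesis by (metis of_real_mult of_real_numeral of_real_power)
  qed
  define e where "e t = complex_of_real (exp (2/3 * t))" for t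
  define e' where "e' t = complex_of_real (exp ((-2/3) * t))" for t
  have ee': "e t * e' t = 1" for t
    by (simp add: e_def e'_def of_real_mult[symmetric] exp_add[symmetric] del: of_real_mult)
  have Oe: "exp_bigo (2/3) e" and Oe': "exp_bigo (-2/3) e'"
    unfolding e_def[abs_def] e'_def[abs_def] by (rule landau_o.big_refl)+
  have Oe2: "exp_bigo (4/3) (\<lambda>t. e t ^ 2)"
    unfolding power2_eq_square by (rule exp_bigo_mult[OF Oe Oe]) simp
  define mp where "mp = mon \<omega> \<nu> 1 1"
  define mm where "mm = mon \<omega> \<nu> 1 (-1)"
  have Omp: "exp_bigo (- c) mp" and Omm: "exp_bigo (- c) mm"
    unfolding mp_def mm_def c
    by (rule exp_bigo_mono[OF exp_bigo_mon]; simp add: field_simps)+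
  have V1': "V1 t = A * mp t + B * mm t" for t by (simp add: V1 mp_def mm_def)
  have OV1: "exp_bigo (- c) V1"
    unfolding V1'[abs_def] by (intro sum_in_bigo exp_bigo_cmult Omp Omm)
  have OV2: "exp_bigo (- 2 * c) V2"
    unfolding V2[abs_def] using exp_bigo_mon[of _ 2 \<omega> \<nu>]
    by (intro big_sum_in_bigo exp_bigo_cmult) (auto simp: c)
  define V where "V t = Z t - 1" for t
  have OW: "exp_bigo (- 3 * c) (\<lambda>t. V t - V1 t - V2 t)"
    using Z by (simp add: V_def)
  have OVV1: "exp_bigo (- 2 * c) (\<lambda>t. V t - V1 t)"
    using sum_in_bigo(1)[OF exp_bigo_mono[OF OW, of "- 2 * c"] OV2] c_bounds by simp
  have OV: "exp_bigo (- c) V"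
    using sum_in_bigo(1)[OF exp_bigo_mono[OF OVV1, of "- c"] OV1] c_bounds by simp
  have V_lim: "(V \<longlongrightarrow> 0) at_top" using exp_bigo_tendsto_0[OF OV] c_bounds by simp
  then have "\<forall>\<^sub>F t in at_top. dist (V t) 0 < 1/2" by (rule tendstoD) simp
  then obtain t2 where t2: "\<And>t. t \<ge> t2 \<Longrightarrow> cmod (V t) < 1/2"
    by (auto simp: eventually_at_top_linorder)
  \<comment> \<open>Beyond \<open>t0\<close> the values of \<open>Z\<close> lie within 1/2 of 1,
    hence off the branch cut of \<open>Ln\<close>, so \<open>p\<close> is differentiable with
    derivative \<open>p1\<close>.\<close>
  define t0 where "t0 = max t1 t2"
  have ev: "\<forall>\<^sub>F t in at_top. t \<ge> t0" by (rule eventually_ge_at_top)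
  have V_small: "cmod (V t) < 1/2" and p1: "(p1 has_vector_derivative
        4 * of_real \<beta> ^ 2 * of_real (exp (2/3 * t)) ^ 2 * ((1 / Z t) ^ 2 - Z t)
        + 4 * a * of_real \<beta> * of_real (exp (2/3 * t)) * (1 / Z t)) (at t)"
    and E: "(E has_vector_derivative
        2 * a / 3 + 2 * of_real \<beta> * of_real (exp (2/3 * t)) * (1 / Z t - 1)) (at t)"
    if "t \<ge> t0" for t
    using that t2 p1_deriv E_deriv by (auto simp: t0_def)
  have Re_Z: "Re (Z t) > 0" if "t \<ge> t0" for t
    using abs_Re_le_cmod[of "V t"] V_small[OF that] by (simp add: V_def)
  have Z_nz: "Z t \<noteq> 0" if "t \<ge> t0" for t
    using Re_Z[OF that] by auto
  define p where "p t = Ln (Z t)" for t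
  have p: "(p has_vector_derivative p1 t) (at t)" if t: "t \<ge> t0" for t
  proof -
    have "(Ln has_field_derivative inverse (Z t)) (at (Z t))"
      using Re_Z[OF t] by (intro has_field_derivative_Ln) (auto simp: complex_nonpos_Reals_iff)
    from field_vector_diff_chain_at[OF Z_deriv this] show ?thesis
      using t Z_nz[OF t] by (simp add: o_def p_def[abs_def] t0_def mult.assoc)
  qed
  from tendsto_add[OF V_lim tendsto_const[of 1]]
  have Z_lim: "(Z \<longlongrightarrow> 1) at_top"
    by (simp add: V_def)
  have OZ: "exp_bigo 0 Z"
    using Z_lim by (intro bigoI_tendsto[of _ _ 1]) auto
  have OZi: "exp_bigo 0 (\<lambda>t. 1 / Z t)"
    using tendsto_divide[OF tendsto_const[of 1] Z_lim] by (intro bigoI_tendsto[of _ _ 1]) auto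
  define x where "x t = 1 / Z t - 1" for t
  have OV2': "exp_bigo (- 2 * c) (\<lambda>t. V t * V t)"
    by (rule exp_bigo_mult[OF OV OV]) simp
  have p_approx: "exp_bigo (- 2 * c) (\<lambda>t. p t - V t)"
  proof (rule landau_o.big_trans[OF _ OV2'])
    show "(\<lambda>t. p t - V t) \<in> O(\<lambda>t. V t * V t)"
    proof (intro bigoI[of _ 2] eventually_mono[OF ev])
      fix t assume t: "t \<ge> t0"
      have "cmod (p t - V t) \<le> cmod (V t) ^ 2 / (1 - cmod (V t))"
        using Ln_approx_linear[of "V t"] V_small[OF t] by (simp add: p_def V_def)
      also have "\<dots> \<le> cmod (V t) ^ 2 / (1/2)"
        using V_small[OF t] by (intro divide_left_mono) auto
      finally show "cmod (p t - V t) \<le> 2 * cmod (V t * V t)"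
        by (simp add: norm_mult power2_eq_square)
    qed
  qed
  have OV3': "exp_bigo (- 3 * c) (\<lambda>t. V t * (V t * V t))"
    using exp_bigo_mult[OF OV OV2', of "- 3 * c"] by simp
  \<comment> \<open>Since \<open>x = 1 / (1 + V) - 1\<close>, this and the next bound are the
    geometric series \<open>x = - V + V^2 - ...\<close> stopped after one and two terms, with exact
    remainders \<open>V^2 / Z\<close> and \<open>- V^3 / Z\<close>.\<close>
  have OxV: "exp_bigo (- 2 * c) (\<lambda>t. x t + V t)"
  proof -
    have "\<forall>\<^sub>F t in at_top. x t + V t = (V t * V t) * (1 / Z t)"
      by (intro eventually_mono[OF ev]) (use Z_nz in \<open>simp add: x_def V_def field_simps\<close>)
    then show ?thesis
      by (rule landau_o.big.in_cong[THEN iffD2]) (rule exp_bigo_mult[OF OV2' OZi], simp)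
  qed
  have OxVV: "exp_bigo (- 3 * c) (\<lambda>t. x t + V t - V t * V t)"
  proof -
    have "\<forall>\<^sub>F t in at_top. x t + V t - V t * V t = - ((V t * (V t * V t)) * (1 / Z t))"
      by (intro eventually_mono[OF ev]) (use Z_nz in \<open>simp add: x_def V_def field_simps\<close>)
    then show ?thesis
      by (rule landau_o.big.in_cong[THEN iffD2])
        (simp only: landau_o.big.uminus_in_iff, rule exp_bigo_mult[OF OV3' OZi], simp)
  qed
  \<comment> \<open>\<open>d\<close> and \<open>y\<close> are the errors of the approximations
    \<open>x = - V1\<close> and \<open>x = - V1 + V1^2 - V2\<close>, accurate to first and second
    order.\<close>
  define d where "d t = x t + V1 t" for t
  define y where "y t = x t + V1 t - V1 t * V1 t + V2 t" for t
  have Od: "exp_bigo (- 2 * c) d"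
  proof -
    have "d = (\<lambda>t. (x t + V t) - (V t - V1 t))" by (auto simp: d_def)
    then show ?thesis using sum_in_bigo(2)[OF OxV OVV1] by simp
  qed
  have Oy: "exp_bigo (- 3 * c) y"
  proof -
    have "exp_bigo (- c) (\<lambda>t. V t + V1 t)" by (intro sum_in_bigo OV OV1)
    then have P: "exp_bigo (- 3 * c) (\<lambda>t. (V t - V1 t) * (V t + V1 t))"
      by (rule exp_bigo_mult[OF OVV1]) simp
    have "y = (\<lambda>t. (x t + V t - V t * V t) + (V t - V1 t) * (V t + V1 t) - (V t - V1 t - V2 t))"
      by (auto simp: y_def algebra_simps)
    then show ?thesis by (simp only:) (intro sum_in_bigo OxVV P OW)
  qed
  have Ox: "exp_bigo (- c) x"
  proof -
    have "x = (\<lambda>t. d t - V1 t)" by (auto simp: d_def)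
    then show ?thesis
      using exp_bigo_mono[OF Od, of "- c"] OV1 c_bounds by (auto intro!: sum_in_bigo)
  qed

  define cub where "cub t = x t ^ 3 * Z t" for t
  \<comment> \<open>These are the terms of orders 3 and 4 of \<open>x^3 * Z\<close>, obtained from
    \<open>x = - V1 + (V1^2 - V2)\<close> and \<open>Z = 1 + V1\<close>.\<close>
  define T where "T t = - (V1 t ^ 3) + (V1 t * V1 t) * (2 * (V1 t * V1 t) - 3 * V2 t)" for t
  have OV11: "exp_bigo (- 2 * c) (\<lambda>t. V1 t * V1 t)"
    by (rule exp_bigo_mult[OF OV1 OV1]) simp
  have OcubT: "exp_bigo (- 5 * c) (\<lambda>t. cub t - T t)"
  proof -
    have dd: "exp_bigo (- 4 * c) (\<lambda>t. d t * d t)"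
      by (rule exp_bigo_mult[OF Od Od]) simp
    have 1: "exp_bigo (- 5 * c) (\<lambda>t. (d t * d t) * d t)"
      by (rule exp_bigo_mult[OF dd Od]) (use c_bounds in simp)
    have 2: "exp_bigo (- 5 * c) (\<lambda>t. 3 * ((d t * d t) * V1 t))"
      using exp_bigo_mult[OF dd OV1, of "- 5 * c"] by (simp add: exp_bigo_cmult)
    have 3: "exp_bigo (- 5 * c) (\<lambda>t. 3 * (y t * (V1 t * V1 t)))"
      using exp_bigo_mult[OF Oy OV11, of "- 5 * c"] by (simp add: exp_bigo_cmult)
    have q: "exp_bigo (- 2 * c) (\<lambda>t. x t * x t - x t * V1 t + V1 t * V1 t)"
      using exp_bigo_mult[OF Ox Ox, of "- 2 * c"] exp_bigo_mult[OF Ox OV1, of "- 2 * c"] OV11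
      by (auto intro!: sum_in_bigo)
    have q': "exp_bigo (- 4 * c) (\<lambda>t. d t * (x t * x t - x t * V1 t + V1 t * V1 t))"
      by (rule exp_bigo_mult[OF Od q]) simp
    have 4: "exp_bigo (- 5 * c) (\<lambda>t. V t * (d t * (x t * x t - x t * V1 t + V1 t * V1 t)))"
      using exp_bigo_mult[OF OV q', of "- 5 * c"] by simp
    have "exp_bigo (- 3 * c) (\<lambda>t. V1 t * (V1 t * V1 t))"
      by (rule exp_bigo_mult[OF OV1 OV11]) simp
    from exp_bigo_mult[OF this OVV1, of "- 5 * c"]
    have 5: "exp_bigo (- 5 * c) (\<lambda>t. (V1 t * (V1 t * V1 t)) * (V t - V1 t))" by simp
    \<comment> \<open>Cube \<open>x = d - V1\<close>, replace the linear \<open>d\<close> by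
      \<open>y + V1^2 - V2\<close>, and split \<open>x^3 * V\<close> through
      \<open>x^3 + V1^3 = d * (x^2 - x * V1 + V1^2)\<close>. Every summand then has order at least
      5.\<close>
    have "cub t - T t = (d t * d t) * d t - 3 * ((d t * d t) * V1 t) + 3 * (y t * (V1 t * V1 t))
       + V t * (d t * (x t * x t - x t * V1 t + V1 t * V1 t)) - (V1 t * (V1 t * V1 t)) * (V t - V1 t)" for t
    proof -
      have Zt: "Z t = 1 + V t" by (simp add: V_def)
      show ?thesis
        unfolding cub_def T_def Zt d_def y_def by (simp add: algebra_simps power3_eq_cube)
    qed
    then show ?thesis using 1 2 3 4 5 by (simp only:) (intro sum_in_bigo)
  qed
  have Ocub: "exp_bigo (- 3 * c) cub"
  proof -
    have "exp_bigo (- 2 * c) (\<lambda>t. x t * x t)" by (rule exp_bigo_mult[OF Ox Ox]) simp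
    from exp_bigo_mult[OF Ox this, of "- 3 * c"] have "exp_bigo (- 3 * c) (\<lambda>t. x t * (x t * x t))" by simp
    from exp_bigo_mult[OF this OZ, of "- 3 * c"] show ?thesis
      by (simp add: cub_def[abs_def] power3_eq_cube mult.assoc)
  qed
  have prim_cub: "primitive_bigo (- 2 * c) (\<lambda>t. e t * cub t)"
  proof (rule primitive_bigo_perturb)
    have 3: "primitive_bigo (- 2 * c) (\<lambda>t. e t * V1 t ^ 3)"
      unfolding e_def using \<omega>0 V1 c c_bounds by (intro primitive_bigo_order_3) auto
    define b1 where "b1 j = (if j = 2 then A\<^sup>2 else if j = 0 then 2 * A * B else if j = -2 then B\<^sup>2 else 0)" for j :: int
    have set: "{-2..2::int} = {-2, -1, 0, 1, 2}" by auto
    have prods: "mon \<omega> \<nu> 2 2 t = mp t * mp t" "mon \<omega> \<nu> 2 0 t = mp t * mm t"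
      "mon \<omega> \<nu> 2 (-2) t = mm t * mm t" for t
      by (simp_all add: mp_def mm_def mon_mult numeral_2_eq_2)
    have b1: "V1 t * V1 t = (\<Sum>j=-2..2. b1 j * mon \<omega> \<nu> 2 j t)" for t
      by (simp add: set b1_def prods V1' algebra_simps power2_eq_square)
    have b2: "2 * (V1 t * V1 t) - 3 * V2 t = (\<Sum>j=-2..2. (2 * b1 j - 3 * coeff j) * mon \<omega> \<nu> 2 j t)" for t
      unfolding b1 V2 by (simp add: sum_distrib_left sum_subtractf left_diff_distrib mult.assoc)
    have 4: "primitive_bigo (- 2 * c) (\<lambda>t. e t * ((V1 t * V1 t) * (2 * (V1 t * V1 t) - 3 * V2 t)))"
      unfolding e_def using c_bounds \<omega>0 by (intro primitive_bigo_order_4[OF _ b1 b2]) (auto simp: c)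
    show "primitive_bigo (- 2 * c) (\<lambda>t. (-1) * (e t * V1 t ^ 3) + e t * ((V1 t * V1 t) * (2 * (V1 t * V1 t) - 3 * V2 t)))"
      by (intro primitive_bigo_add primitive_bigo_cmult 3 4)
    have "exp_bigo (- 2 * c) (\<lambda>t. e t * (cub t - T t))"
      using c_bounds by (intro exp_bigo_mult[OF Oe OcubT]) auto
    then show "exp_bigo (- 2 * c) (\<lambda>t. e t * cub t -
        ((-1) * (e t * V1 t ^ 3) + e t * ((V1 t * V1 t) * (2 * (V1 t * V1 t) - 3 * V2 t))))"
      by (simp add: T_def algebra_simps)
  qed
  have prim_x: "primitive_bigo (- 2 * c) x"
  proof (rule primitive_bigo_perturb)
    have m: "mp = (\<lambda>t. e t * mon \<omega> \<nu> 3 1 t)" "mm = (\<lambda>t. e t * mon \<omega> \<nu> 3 (-1) t)"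
      unfolding mp_def mm_def e_def exp_times_mon by (rule refl)+
    have "primitive_bigo (- 2 * c) mp" "primitive_bigo (- 2 * c) mm"
      unfolding m unfolding e_def using c_bounds c by (intro primitive_bigo_mon \<omega>0; simp)+
    then show "primitive_bigo (- 2 * c) (\<lambda>t. (-A) * mp t + (-B) * mm t)"
      by (intro primitive_bigo_add primitive_bigo_cmult)
    show "exp_bigo (- 2 * c) (\<lambda>t. x t - ((-A) * mp t + (-B) * mm t))"
      using Od by (simp add: d_def[abs_def] V1' algebra_simps)
  qed

  define lp where "lp t = (- 1 / 3 + 2 / 3 * \<nu>) + \<i> * of_real \<omega> * (2 / 3) * e t" for t
  define lm where "lm t = (- 1 / 3 - 2 / 3 * \<nu>) - \<i> * of_real \<omega> * (2 / 3) * e t" for t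
  have dmp: "(mp has_vector_derivative lp t * mp t) (at t)" for t
    using mon_has_vector_derivative[of \<omega> \<nu> 1 1 t] by (simp add: mp_def lp_def e_def algebra_simps)
  have dmm: "(mm has_vector_derivative lm t * mm t) (at t)" for t
    using mon_has_vector_derivative[of \<omega> \<nu> 1 "-1" t] by (simp add: mm_def lm_def e_def algebra_simps)
  have de: "(e has_vector_derivative 2 / 3 * e t) (at t)" for t
    unfolding e_def[abs_def] by (auto intro!: derivative_eq_intros)
  have de': "(e' has_vector_derivative - 2 / 3 * e' t) (at t)" for t
    unfolding e'_def[abs_def] by (auto intro!: derivative_eq_intros)
  have dlp: "(lp has_vector_derivative \<i> * of_real \<omega> * (2 / 3) * (2 / 3 * e t)) (at t)" for t
    unfolding lp_def[abs_def] by (auto intro!: derivative_eq_intros de)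
  have dlm: "(lm has_vector_derivative - (\<i> * of_real \<omega> * (2 / 3) * (2 / 3 * e t))) (at t)" for t
    unfolding lm_def[abs_def] by (auto intro!: derivative_eq_intros de)
  define V1d where "V1d t = A * (lp t * mp t) + B * (lm t * mm t)" for t
  define V1dd where "V1dd t = A * (lp t * (lp t * mp t) + \<i> * of_real \<omega> * (2 / 3) * (2 / 3 * e t) * mp t)
      + B * (lm t * (lm t * mm t) + (- (\<i> * of_real \<omega> * (2 / 3) * (2 / 3 * e t))) * mm t)" for t
  have dV1: "(V1 has_vector_derivative V1d t) (at t)" for t
    unfolding V1'[abs_def] V1d_def by (intro derivative_intros dmp dmm)
  have dV1d: "(V1d has_vector_derivative V1dd t) (at t)" for t
    unfolding V1d_def[abs_def] V1dd_def
    by (intro has_vector_derivative_add has_vector_derivative_mult_right has_vector_derivative_mult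
        dmp dmm dlp dlm)
  define p2 where "p2 t = 4 * of_real \<beta> ^ 2 * e t ^ 2 * ((1 / Z t) ^ 2 - Z t)
        + 4 * a * of_real \<beta> * e t * (1 / Z t)" for t
  have dp1: "(p1 has_vector_derivative p2 t) (at t)" if "t \<ge> t0" for t
    using p1[OF that] by (simp add: p2_def e_def)
  have nonlin: "(1 / Z t) ^ 2 - Z t = 3 * x t + cub t" if "t \<ge> t0" for t
    using Z_nz[OF that] by (simp add: x_def cub_def field_simps power2_eq_square power3_eq_cube)
  have Op: "exp_bigo (- c) p"
    using sum_in_bigo(1)[OF exp_bigo_mono[OF p_approx, of "- c"] OV] c_bounds by simp
  have OpV1: "exp_bigo (- 2 * c) (\<lambda>t. p t - V1 t)"
    using sum_in_bigo(1)[OF p_approx OVV1] by simp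
  have OD1: "exp_bigo (- 2 * c + 2 / 3) (\<lambda>t. p1 t - V1d t)"
  proof (rule exp_bigo_interpolate)
    show "((\<lambda>t. p t - V1 t) has_vector_derivative p1 t - V1d t) (at t)" if "t \<ge> t0" for t
      by (intro derivative_intros p that dV1)
    show "((\<lambda>t. p1 t - V1d t) has_vector_derivative p2 t - V1dd t) (at t)" if "t \<ge> t0" for t
      by (intro derivative_intros dp1 that dV1d)
    \<comment> \<open>\<open>kp\<close> and \<open>km\<close> are the parts of the coefficients of
      \<open>mp\<close> and \<open>mm\<close> in \<open>V1dd\<close> that are at most linear in
      \<open>e\<close>; the quadratic part is \<open>- 12 \<beta>^2 e^2\<close> for both.\<close>
    define kp where "kp t = (- 1 / 3 + 2 / 3 * \<nu>)\<^sup>2 + (2 * (- 1 / 3 + 2 / 3 * \<nu>) + 2 / 3) * (\<i> * of_real \<omega> * (2 / 3)) * e t" for t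
    define km where "km t = (- 1 / 3 - 2 / 3 * \<nu>)\<^sup>2 - (2 * (- 1 / 3 - 2 / 3 * \<nu>) + 2 / 3) * (\<i> * of_real \<omega> * (2 / 3)) * e t" for t
    have s2: "(\<i> * of_real \<omega> * (2 / 3) * e t)\<^sup>2 = - 12 * of_real \<beta> ^ 2 * e t ^ 2" for t
      by (simp add: power_mult_distrib \<omega>_sq power_divide)
    have lp2: "lp t * lp t + \<i> * of_real \<omega> * (2 / 3) * (2 / 3 * e t) = kp t - 12 * of_real \<beta> ^ 2 * e t ^ 2" for t
    proof -
      have "lp t * lp t + \<i> * of_real \<omega> * (2 / 3) * (2 / 3 * e t) = kp t + (\<i> * of_real \<omega> * (2 / 3) * e t)\<^sup>2"
        by (simp add: lp_def kp_def power2_eq_square field_simps)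
      then show ?thesis unfolding s2 by simp
    qed
    have lm2: "lm t * lm t - \<i> * of_real \<omega> * (2 / 3) * (2 / 3 * e t) = km t - 12 * of_real \<beta> ^ 2 * e t ^ 2" for t
    proof -
      have "lm t * lm t - \<i> * of_real \<omega> * (2 / 3) * (2 / 3 * e t) = km t + (\<i> * of_real \<omega> * (2 / 3) * e t)\<^sup>2"
        by (simp add: lm_def km_def power2_eq_square field_simps)
      then show ?thesis unfolding s2 by simp
    qed
    have V1dd: "V1dd t = A * (kp t * mp t) + B * (km t * mm t) - 12 * of_real \<beta> ^ 2 * (e t ^ 2 * V1 t)" for t
    proof -
      have "V1dd t = A * ((lp t * lp t + \<i> * of_real \<omega> * (2 / 3) * (2 / 3 * e t)) * mp t)
         + B * ((lm t * lm t - \<i> * of_real \<omega> * (2 / 3) * (2 / 3 * e t)) * mm t)"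
        by (simp add: V1dd_def algebra_simps)
      then show ?thesis unfolding lp2 lm2 V1' by (simp add: algebra_simps)
    qed
    have const: "exp_bigo (2/3) (\<lambda>t. k)" for k
      by (rule exp_bigo_mono[of _ 0]) simp_all
    have kp: "exp_bigo (2/3) kp" and km: "exp_bigo (2/3) km"
      unfolding kp_def[abs_def] km_def[abs_def] by (intro sum_in_bigo const exp_bigo_cmult Oe)+
    have k: "exp_bigo (- 2 * c + 2 * (2/3)) (\<lambda>t. kp t * mp t)" "exp_bigo (- 2 * c + 2 * (2/3)) (\<lambda>t. km t * mm t)"
      using c_bounds by (intro exp_bigo_mult[OF kp Omp] exp_bigo_mult[OF km Omm]; simp)+
    have 1: "exp_bigo (- 2 * c + 2 * (2/3)) (\<lambda>t. e t ^ 2 * d t)"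
      by (rule exp_bigo_mult[OF Oe2 Od]) simp
    have 2: "exp_bigo (- 2 * c + 2 * (2/3)) (\<lambda>t. e t ^ 2 * cub t)"
      by (rule exp_bigo_mult[OF Oe2 Ocub]) (use c_bounds in simp)
    have 3: "exp_bigo (- 2 * c + 2 * (2/3)) (\<lambda>t. e t * (1 / Z t))"
      by (rule exp_bigo_mult[OF Oe OZi]) (use c_bounds in simp)
    \<comment> \<open>The two largest contributions, \<open>12 \<beta>^2 e^2 x\<close> from the
      equation and \<open>12 \<beta>^2 e^2 V1\<close> from \<open>- V1dd\<close>, combine into the
      small \<open>d\<close>.\<close>
    have "\<forall>\<^sub>F t in at_top. p2 t - V1dd t = 12 * of_real \<beta> ^ 2 * (e t ^ 2 * d t) + 4 * of_real \<beta> ^ 2 * (e t ^ 2 * cub t)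
        + 4 * a * of_real \<beta> * (e t * (1 / Z t)) - (A * (kp t * mp t) + B * (km t * mm t))"
      by (intro eventually_mono[OF ev]) (simp only: p2_def nonlin V1dd d_def, simp add: algebra_simps)
    then show "exp_bigo (- 2 * c + 2 * (2/3)) (\<lambda>t. p2 t - V1dd t)"
      by (subst landau_o.big.in_cong, assumption) (intro sum_in_bigo exp_bigo_cmult 1 2 3 k)
  qed (use OpV1 in auto)

  \<comment> \<open>The dominant part of \<open>e' * V1d / (6 * \<beta>)\<close>: the prefactor is
    \<open>(2/3) i \<omega> / (6 \<beta>) = i / sqrt 3\<close>, and the sign change at
    \<open>mm\<close> comes from its opposite frequency.\<close>
  define L where "L t = \<i> / of_real (sqrt 3) * (A * mp t - B * mm t)" for t
  \<comment> \<open>The equation puts \<open>2 * \<beta> * e * x\<close> into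
    \<open>e' * p2 / (6 * \<beta>)\<close>, which cancels the large term of the derivative of
    \<open>E\<close>; the constant \<open>2 * a / 3\<close> cancels as well. The summand
    \<open>2 / 3 * p\<close> removes the \<open>p1\<close> produced by differentiating
    \<open>e'\<close>.\<close>
  define R where "R t = E t - 1 / (6 * of_real \<beta>) * (e' t * (p1 t + 2 / 3 * p t))" for t
  have dR: "(R has_vector_derivative 2 / (27 * of_real \<beta>) * (e' t * p t)
      + (- (2 * of_real \<beta> / 3)) * (e t * cub t) + (- (2 * a / 3)) * x t) (at t)" if t: "t \<ge> t0" for t
  proof -
    have "(R has_vector_derivative (2 * a / 3 + 2 * of_real \<beta> * e t * x t)
       - 1 / (6 * of_real \<beta>) * (e' t * (p2 t + 2 / 3 * p1 t) + (- 2 / 3 * e' t) * (p1 t + 2 / 3 * p t))) (at t)"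
      unfolding R_def[abs_def] using E[OF t] unfolding e_def[symmetric] x_def[symmetric]
      by (intro derivative_intros dp1 t p de')
    also have "e' t * (p2 t + 2 / 3 * p1 t) + (- 2 / 3 * e' t) * (p1 t + 2 / 3 * p t) =
       4 * of_real \<beta> ^ 2 * (e t * e' t) * e t * (3 * x t + cub t) + 4 * a * of_real \<beta> * (e t * e' t) * (1 + x t)
       - 4 / 9 * (e' t * p t)"
      unfolding p2_def nonlin[OF t] by (simp add: x_def power2_eq_square algebra_simps)
    also have "(2 * a / 3 + 2 * of_real \<beta> * e t * x t) - 1 / (6 * of_real \<beta>) *
        (4 * of_real \<beta> ^ 2 * (e t * e' t) * e t * (3 * x t + cub t) + 4 * a * of_real \<beta> * (e t * e' t) * (1 + x t)
         - 4 / 9 * (e' t * p t)) =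
      2 / (27 * of_real \<beta>) * (e' t * p t) + (- (2 * of_real \<beta> / 3)) * (e t * cub t) + (- (2 * a / 3)) * x t"
      unfolding ee' using \<beta> by (simp add: field_simps power2_eq_square)
    finally show ?thesis .
  qed
  have Oe'p: "exp_bigo (- 2 * c) (\<lambda>t. e' t * p t)"
    using c_bounds by (intro exp_bigo_mult[OF Oe' Op]) auto
  have Oe'D1: "exp_bigo (- 2 * c) (\<lambda>t. e' t * (p1 t - V1d t))"
    by (intro exp_bigo_mult[OF Oe' OD1]) auto
  have OL: "exp_bigo (- 2 * c) (\<lambda>t. 1 / (6 * of_real \<beta>) * (e' t * V1d t) - L t)"
  proof -
    have w: "\<i> * complex_of_real \<omega> * (2 / 3) = 6 * of_real \<beta> * (\<i> / of_real (sqrt 3))"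
    proof -
      have "complex_of_real (sqrt 3) * of_real (sqrt 3) = 3"
        by (simp add: of_real_mult[symmetric] del: of_real_mult)
      then show ?thesis by (simp add: \<omega> field_simps)
    qed
    have "e' t * V1d t = A * ((- 1 / 3 + 2 / 3 * \<nu>) * (e' t * mp t)) + B * ((- 1 / 3 - 2 / 3 * \<nu>) * (e' t * mm t))
       + (e t * e' t) * (\<i> * complex_of_real \<omega> * (2 / 3)) * (A * mp t - B * mm t)" for t
      by (simp add: V1d_def lp_def lm_def field_simps)
    then have "1 / (6 * of_real \<beta>) * (e' t * V1d t) - L t =
      1 / (6 * of_real \<beta>) * (A * ((- 1 / 3 + 2 / 3 * \<nu>) * (e' t * mp t)) + B * ((- 1 / 3 - 2 / 3 * \<nu>) * (e' t * mm t)))" for t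
      unfolding ee' w L_def using \<beta> by (simp add: distrib_left)
    moreover have "exp_bigo (- 2 * c) (\<lambda>t. e' t * mp t)" "exp_bigo (- 2 * c) (\<lambda>t. e' t * mm t)"
      using c_bounds by (intro exp_bigo_mult[OF Oe' Omp] exp_bigo_mult[OF Oe' Omm]; simp)+
    ultimately show ?thesis
      by (simp only:) (intro sum_in_bigo exp_bigo_cmult)
  qed
  define S where "S t = 1 / (6 * of_real \<beta>) * (e' t * (p1 t - V1d t)) + 1 / (6 * of_real \<beta>) * (2 / 3 * (e' t * p t))
      + (1 / (6 * of_real \<beta>) * (e' t * V1d t) - L t)" for t
  have OS: "exp_bigo (- 2 * c) S"
    unfolding S_def[abs_def] by (intro sum_in_bigo exp_bigo_cmult Oe'D1 Oe'p OL)
  have ER: "E t - L t = R t + S t" for t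
    by (simp add: R_def S_def algebra_simps)
  have OLc: "exp_bigo (- c) L"
    unfolding L_def[abs_def] by (intro exp_bigo_cmult sum_in_bigo Omp Omm)
  \<comment> \<open>The decay of \<open>E\<close> enters here: it fixes the constant of integration
    by forcing \<open>R\<close> to vanish at infinity.\<close>
  have "R = (\<lambda>t. E t - L t - S t)" using ER by (auto simp: fun_eq_iff algebra_simps)
  moreover have "((\<lambda>t. E t - L t - S t) \<longlongrightarrow> 0 - 0 - 0) at_top"
    using c_bounds by (intro tendsto_diff E_lim exp_bigo_tendsto_0[OF OLc] exp_bigo_tendsto_0[OF OS]) auto
  ultimately have R_lim: "(R \<longlongrightarrow> 0) at_top" by simp
  have "exp_bigo (- 2 * c) R"
  proof (rule exp_bigo_from_primitive_bigo[OF dR _ _ R_lim])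
    show "primitive_bigo (- 2 * c) (\<lambda>t. 2 / (27 * of_real \<beta>) * (e' t * p t)
      + (- (2 * of_real \<beta> / 3)) * (e t * cub t) + (- (2 * a / 3)) * x t)"
      by (intro primitive_bigo_add primitive_bigo_cmult prim_cub prim_x exp_bigo_imp_primitive_bigo[OF Oe'p])
  qed (use c_bounds in auto)
  from sum_in_bigo(1)[OF this OS] show ?thesis
    unfolding ER[symmetric] L_def mp_def mm_def .
qed

section \<open>Translation of the hypotheses to logarithmic time\<close>

lemma has_vector_derivative_inverse:
  fixes f :: "real \<Rightarrow> complex"
  assumes "(f has_vector_derivative f') (at x)" "f x \<noteq> 0"
  shows "((\<lambda>x. inverse (f x)) has_vector_derivative - f' / (f x)\<^sup>2) (at x)"
  using field_vector_diff_chain_at[OF assms(1) DERIV_inverse[OF assms(2)]]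
  by (simp add: o_def power2_eq_square divide_inverse)

lemma has_vector_derivative_compose_exp:
  fixes f :: "real \<Rightarrow> complex"
  assumes "(f has_vector_derivative f') (at (exp t))"
  shows "((\<lambda>t. f (exp t)) has_vector_derivative of_real (exp t) * f') (at t)"
proof -
  have "(exp has_vector_derivative exp t) (at t)"
    unfolding has_real_derivative_iff_has_vector_derivative[symmetric] by (rule DERIV_exp)
  from vector_diff_chain_at[OF this assms] show ?thesis
    by (simp add: o_def scaleR_conv_of_real)
qed

lemma exp_powr: "exp t powr x = exp (x * t)" for t x :: real
  by (simp add: powr_def)

lemma theta_exp: "theta \<epsilon> b (exp t) = 3 * sqrt 3 * (\<epsilon> * b) powr (1/3) * exp (2 / 3 * t)"
proof -
  have "(3::real) powr (3/2) = 3 powr 1 * 3 powr (1/2)"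
    unfolding powr_add[symmetric] by simp
  then show ?thesis by (simp add: theta_def exp_powr powr_half_sqrt)
qed

lemma w_fun_exp:
  assumes "\<omega> = 3 * sqrt 3 * (\<epsilon> * b) powr (1/3)"
  shows "w_fun \<epsilon> b \<nu> (exp t) = exp (2 / 3 * \<nu> * of_real t + \<i> * of_real \<omega> * of_real (exp (2 / 3 * t)))"
proof -
  have "complex_of_real (exp t) powr (2/3 * \<nu>) = exp (2 / 3 * \<nu> * of_real t)"
    by (simp add: powr_def Ln_of_real)
  then show ?thesis
    by (simp add: w_fun_def theta_exp assms exp_add mult.assoc)
qed

lemma mon_eq_w_fun:
  assumes "\<omega> = 3 * sqrt 3 * (\<epsilon> * b) powr (1/3)"
  shows "mon \<omega> \<nu> k j t = of_real (exp t powr (- real k / 3)) * w_fun \<epsilon> b \<nu> (exp t) powi j"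
  unfolding w_fun_exp[OF assms] exp_power_int mon_def exp_powr
  by (simp add: mult_exp_exp exp_of_real[symmetric])

text \<open>The expansion is truncated at \<open>N = 2\<close>. Its remainder is measured by
  \<open>exp (- t) * (|w|^3 + |w|^(-3))\<close> with \<open>|w| = exp (2/3 * Re \<nu> * t)\<close>,
  and this is at most \<open>2 * exp (- 3 * c * t)\<close>.\<close>

lemma expansion_at_exp:
  assumes "u_complete_expansion \<epsilon> b \<nu> s z u" and \<omega>: "\<omega> = 3 * sqrt 3 * (\<epsilon> * b) powr (1/3)"
    and Re_nu: "\<bar>Re \<nu>\<bar> < 1/6" and c: "c = (1 - 2 * \<bar>Re \<nu>\<bar>) / 3"
    and AB: "\<And>\<sigma>. AB \<sigma> = s * exp (3 * pi * \<i> / 4) / of_real (3 powr (1/4) * (\<epsilon> * b) powr (1/6))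
           * exp (of_int \<sigma> * (\<nu> * of_real (ln (3 powr (3/2) * (\<epsilon> * b) powr (1/3))) + z))"
  obtains coeff where
    "exp_bigo (- 3 * c) (\<lambda>t. u (exp t) / of_real (u_lead \<epsilon> b (exp t)) - 1
       - (AB 1 * mon \<omega> \<nu> 1 1 t + AB (-1) * mon \<omega> \<nu> 1 (-1) t)
       - (\<Sum>j=-2..2. coeff j * mon \<omega> \<nu> 2 j t))"
proof -
  obtain a where a: "a 1 0 = 0" "\<And>\<sigma>. \<sigma> \<in> {1, -1} \<Longrightarrow> a 1 \<sigma> = AB \<sigma>" and
    exp: "(\<lambda>\<tau>. u \<tau> / of_real (u_lead \<epsilon> b \<tau>)
                   - (1 + (\<Sum>k=1..2. of_real (\<tau> powr (- real k / 3)) *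
                             (\<Sum>j=-int k..int k. a k j * w_fun \<epsilon> b \<nu> \<tau> powi j))))
             \<in> O[at_top](\<lambda>\<tau>. complex_of_real
                  (\<tau> powr (- real (2 + 1) / 3) *
                   (cmod (w_fun \<epsilon> b \<nu> \<tau>) ^ (2 + 1) + inverse (cmod (w_fun \<epsilon> b \<nu> \<tau>)) ^ (2 + 1))))"
    using assms(1) unfolding u_complete_expansion_def AB by blast
  have sums: "1 + (\<Sum>k=1..2. of_real (exp t powr (- real k / 3)) *
                             (\<Sum>j=-int k..int k. a k j * w_fun \<epsilon> b \<nu> (exp t) powi j)) =
      1 + (AB 1 * mon \<omega> \<nu> 1 1 t + AB (-1) * mon \<omega> \<nu> 1 (-1) t) + (\<Sum>j=-2..2. a 2 j * mon \<omega> \<nu> 2 j t)" for t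
  proof -
    have k: "{1..2::nat} = {1, 2}" and j: "{-1..1::int} = {-1, 0, 1}" by auto
    show ?thesis
      unfolding mon_eq_w_fun[OF \<omega>] k sum_distrib_left using a
      by (simp add: j algebra_simps)
  qed
  have size: "exp_bigo (- 3 * c) (\<lambda>t. complex_of_real
                  (exp t powr (- real (2 + 1) / 3) *
                   (cmod (w_fun \<epsilon> b \<nu> (exp t)) ^ (2 + 1) + inverse (cmod (w_fun \<epsilon> b \<nu> (exp t))) ^ (2 + 1))))"
  proof (intro bigoI[of _ 2] eventually_mono[OF eventually_ge_at_top[of 0]])
    fix t :: real assume t: "0 \<le> t"
    have "cmod (w_fun \<epsilon> b \<nu> (exp t)) = exp (2 / 3 * Re \<nu> * t)"
      unfolding w_fun_exp[OF \<omega>] norm_exp_eq_Re by simp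
    moreover have "exp (2 / 3 * Re \<nu> * t) ^ (2 + 1) = exp (2 * Re \<nu> * t)"
      by (simp add: exp_of_nat_mult[symmetric])
    moreover have "exp t powr (- real (2 + 1) / 3) = exp (- t)"
      by (simp add: exp_powr exp_minus field_simps)
    ultimately have "exp t powr (- real (2 + 1) / 3) *
        (cmod (w_fun \<epsilon> b \<nu> (exp t)) ^ (2 + 1) + inverse (cmod (w_fun \<epsilon> b \<nu> (exp t))) ^ (2 + 1))
      = exp (- t) * (exp (2 * Re \<nu> * t) + exp (- (2 * Re \<nu> * t)))"
      by (simp only: power_inverse exp_minus)
    also have "\<dots> = exp ((- 1 + 2 * Re \<nu>) * t) + exp ((- 1 - 2 * Re \<nu>) * t)"
      by (simp only: distrib_left exp_add[symmetric]) (simp add: algebra_simps)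
    also have "\<dots> \<le> exp (- 3 * c * t) + exp (- 3 * c * t)"
      unfolding c using t by (intro add_mono iffD2[OF exp_le_cancel_iff] mult_right_mono) auto
    finally have "exp t powr (- real (2 + 1) / 3) *
        (cmod (w_fun \<epsilon> b \<nu> (exp t)) ^ (2 + 1) + inverse (cmod (w_fun \<epsilon> b \<nu> (exp t))) ^ (2 + 1)) \<le> 2 * exp (- 3 * c * t)" by simp
    then show "cmod (complex_of_real (exp t powr (- real (2 + 1) / 3) *
        (cmod (w_fun \<epsilon> b \<nu> (exp t)) ^ (2 + 1) + inverse (cmod (w_fun \<epsilon> b \<nu> (exp t))) ^ (2 + 1))))
      \<le> 2 * cmod (complex_of_real (exp (- 3 * c * t)))"
      unfolding norm_of_real by (subst abs_of_nonneg) (auto intro!: mult_nonneg_nonneg add_nonneg_nonneg)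
  qed
  have "exp_bigo (- 3 * c) (\<lambda>t. u (exp t) / of_real (u_lead \<epsilon> b (exp t))
     - (1 + (AB 1 * mon \<omega> \<nu> 1 1 t + AB (-1) * mon \<omega> \<nu> 1 (-1) t) + (\<Sum>j=-2..2. a 2 j * mon \<omega> \<nu> 2 j t)))"
    using landau_o.big_trans[OF landau_o.big.compose[OF exp exp_at_top] size] unfolding sums .
  then show ?thesis
    by (intro that[of "a 2"]) (simp add: algebra_simps)
qed

text \<open>The terms \<open>u'^2 / u\<close> and \<open>- u' / \<tau>\<close> are exactly those
  cancelled on passing to the second derivative of \<open>ln u\<close> with respect to
  \<open>ln \<tau>\<close>. Only the algebraic terms remain, and inserting
  \<open>u = u_lead * Z\<close> gives them the stated form.\<close>

lemma dp3_solution_log_time: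
  fixes \<epsilon> b T :: real
  assumes eps: "\<epsilon> = 1 \<or> \<epsilon> = -1" and b: "\<epsilon> * b > 0" and T: "T \<ge> 0"
    and sol: "dp3_solution \<epsilon> b a T u \<phi>" and \<beta>: "\<beta> = (\<epsilon> * b) powr (1/3)"
    and Z: "\<And>t. Z t = u (exp t) / of_real (u_lead \<epsilon> b (exp t))"
  obtains t1 p1 where
    "\<And>t. t \<ge> t1 \<Longrightarrow> (Z has_vector_derivative p1 t * Z t) (at t)"
    "\<And>t. t \<ge> t1 \<Longrightarrow> (p1 has_vector_derivative
        4 * of_real \<beta> ^ 2 * of_real (exp (2/3 * t)) ^ 2 * ((1 / Z t) ^ 2 - Z t)
        + 4 * a * of_real \<beta> * of_real (exp (2/3 * t)) * (1 / Z t)) (at t)"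
    "\<And>t. t \<ge> t1 \<Longrightarrow> ((\<lambda>t. E_phi \<epsilon> b a \<nu> l \<phi> (exp t)) has_vector_derivative
        2 * a / 3 + 2 * of_real \<beta> * of_real (exp (2/3 * t)) * (1 / Z t - 1)) (at t)"
proof -
  obtain u' where sol': "\<And>\<tau>. \<tau> > T \<Longrightarrow> u \<tau> \<noteq> 0"
      "\<And>\<tau>. \<tau> > T \<Longrightarrow> (u has_vector_derivative u' \<tau>) (at \<tau>)"
      "\<And>\<tau>. \<tau> > T \<Longrightarrow> (u' has_vector_derivative
           ((u' \<tau>)\<^sup>2 / u \<tau> - u' \<tau> / of_real \<tau>
            + 1 / of_real \<tau> * (- 8 * of_real \<epsilon> * (u \<tau>)\<^sup>2 + 2 * a * of_real b)
            + of_real (b\<^sup>2) / u \<tau>)) (at \<tau>)"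
      "\<And>\<tau>. \<tau> > T \<Longrightarrow> (\<phi> has_vector_derivative (2 * a / of_real \<tau> + of_real b / u \<tau>)) (at \<tau>)"
    using sol unfolding dp3_solution_def by blast
  have large: "exp t > T" if "t \<ge> ln (T + 1)" for t
    using that T by (metis add_strict_increasing add.commute exp_le_cancel_iff exp_ln less_add_one less_le_trans zero_less_one)
  \<comment> \<open>The constant in
    \<open>u_lead \<epsilon> b (exp t) = \<kappa> * exp (t / 3)\<close>. The relations
    \<open>b = 2 \<beta> \<kappa>\<close> and \<open>\<beta>^2 = 2 \<epsilon> \<kappa>\<close>
    express every coefficient through it.\<close>
  define \<kappa> where "\<kappa> = \<epsilon> * \<beta>\<^sup>2 / 2"
  have \<beta>0: "\<beta> > 0" unfolding \<beta> powr_gt_zero using b by auto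
  have eps2: "\<epsilon> * \<epsilon> = 1" using eps by auto
  have \<kappa>0: "\<kappa> \<noteq> 0" using \<beta>0 eps by (auto simp: \<kappa>_def)
  have \<beta>3: "\<beta> ^ 3 = \<epsilon> * b"
  proof -
    have "\<beta> ^ 3 = \<beta> powr 3" using \<beta>0 by simp
    also have "\<dots> = \<epsilon> * b" unfolding \<beta> powr_powr using b by simp
    finally show ?thesis .
  qed
  have \<beta>2: "(\<epsilon> * b) powr (2/3) = \<beta>\<^sup>2"
  proof -
    have "\<beta>\<^sup>2 = \<beta> powr 2" using \<beta>0 by simp
    then show ?thesis by (simp add: \<beta> powr_powr)
  qed
  have b\<beta>: "b = 2 * \<beta> * \<kappa>"
  proof -
    have "b = \<epsilon> * (\<epsilon> * b)" using eps2 by (simp add: mult.assoc[symmetric])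
    also have "\<dots> = 2 * \<beta> * \<kappa>" unfolding \<beta>3[symmetric] \<kappa>_def by (simp add: power3_eq_cube power2_eq_square)
    finally show ?thesis .
  qed
  have eps\<beta>: "\<epsilon> * \<beta>\<^sup>2 = 2 * \<kappa>" by (simp add: \<kappa>_def)
  have \<beta>\<kappa>: "\<beta>\<^sup>2 = 2 * \<epsilon> * \<kappa>" using eps2 by (simp add: \<kappa>_def)
  have lead: "u_lead \<epsilon> b (exp t) = \<kappa> * exp (t / 3)" for t
    by (simp add: u_lead_def \<kappa>_def \<beta>2 exp_powr)
  \<comment> \<open>All exponentials that occur are integer powers of \<open>X\<close>, which turns
    the verifications below into identities of rational functions.\<close>
  define X where "X t = complex_of_real (exp (t / 3))" for t
  have X0: "X t \<noteq> 0" for t by (simp add: X_def)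
  have X2: "complex_of_real (exp (2 / 3 * t)) = X t ^ 2" for t
    by (simp add: X_def of_real_power[symmetric] exp_of_nat_mult[symmetric] del: of_real_power)
  have X3: "complex_of_real (exp t) = X t ^ 3" for t
    by (simp add: X_def of_real_power[symmetric] exp_of_nat_mult[symmetric] del: of_real_power)
  have ZX: "Z t = u (exp t) * (1 / of_real \<kappa>) * inverse (X t)" for t
    by (simp add: Z lead X_def field_simps)
  have dX: "(X has_vector_derivative X t / 3) (at t)" for t
    unfolding X_def[abs_def] by (auto intro!: derivative_eq_intros)
  \<comment> \<open>The logarithmic derivative of \<open>u (exp t)\<close> in \<open>t\<close>, less
    the \<open>1 / 3\<close> coming from the factor \<open>exp (t / 3)\<close> of
    \<open>u_lead\<close>.\<close>
  define p1 where "p1 t = X t ^ 3 * u' (exp t) * inverse (u (exp t)) - 1 / 3" for t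
  show ?thesis
  proof (rule that[of "ln (T + 1)" p1])
    fix t assume t: "t \<ge> ln (T + 1)"
    note sol_t = sol'[OF large[OF t]]
    let ?u = "u (exp t)" and ?u' = "u' (exp t)"
    note du = has_vector_derivative_compose_exp[OF sol_t(2), unfolded X3]
    note du' = has_vector_derivative_compose_exp[OF sol_t(3), unfolded X3]
    note d\<phi> = has_vector_derivative_compose_exp[OF sol_t(4), unfolded X3]
    show "(Z has_vector_derivative p1 t * Z t) (at t)"
    proof -
      have "(Z has_vector_derivative ?u * (1 / of_real \<kappa>) * (- (X t / 3) / (X t)\<^sup>2)
          + X t ^ 3 * ?u' * (1 / of_real \<kappa>) * inverse (X t)) (at t)"
        unfolding ZX[abs_def]
        by (intro has_vector_derivative_mult has_vector_derivative_mult_left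
            has_vector_derivative_inverse du dX X0)
      also have "?u * (1 / of_real \<kappa>) * (- (X t / 3) / (X t)\<^sup>2)
          + X t ^ 3 * ?u' * (1 / of_real \<kappa>) * inverse (X t) = p1 t * Z t"
        using sol_t(1) X0[of t] \<kappa>0
        by (simp add: p1_def ZX field_simps power2_eq_square power3_eq_cube)
      finally show ?thesis .
    qed
    show "(p1 has_vector_derivative
        4 * of_real \<beta> ^ 2 * of_real (exp (2/3 * t)) ^ 2 * ((1 / Z t) ^ 2 - Z t)
        + 4 * a * of_real \<beta> * of_real (exp (2/3 * t)) * (1 / Z t)) (at t)"
    proof -
      have dX3: "((\<lambda>t. X t ^ 3) has_vector_derivative X t ^ 3) (at t)"
        unfolding X3[symmetric] by (auto intro!: derivative_eq_intros)
      let ?u'' = "?u'\<^sup>2 / ?u - ?u' / X t ^ 3 + 1 / X t ^ 3 * (- 8 * of_real \<epsilon> * ?u\<^sup>2 + 2 * a * of_real b) + of_real (b\<^sup>2) / ?u"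
      have "(p1 has_vector_derivative
          (X t ^ 3 * ?u' * (- (X t ^ 3 * ?u') / ?u\<^sup>2) + (X t ^ 3 * (X t ^ 3 * ?u'') + X t ^ 3 * ?u') * inverse ?u) - 0) (at t)"
        unfolding p1_def[abs_def]
        by (intro has_vector_derivative_diff has_vector_derivative_mult has_vector_derivative_const
            has_vector_derivative_inverse du du' dX3 sol_t(1))
      also have "(X t ^ 3 * ?u' * (- (X t ^ 3 * ?u') / ?u\<^sup>2) + (X t ^ 3 * (X t ^ 3 * ?u'') + X t ^ 3 * ?u') * inverse ?u) - 0
         = of_real b ^ 2 * X t ^ 6 / ?u\<^sup>2 - 8 * of_real \<epsilon> * X t ^ 3 * ?u + 2 * a * of_real b * X t ^ 3 / ?u"
        using sol_t(1) X0[of t] by (simp add: field_simps power2_eq_square power3_eq_cube eval_nat_numeral)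
      also have "\<dots> = 4 * of_real \<beta> ^ 2 * (X t ^ 2) ^ 2 * ((1 / Z t) ^ 2 - Z t) + 4 * a * of_real \<beta> * X t ^ 2 * (1 / Z t)"
      proof -
        have "4 * of_real \<beta> ^ 2 * (X t ^ 2) ^ 2 * ((1 / Z t) ^ 2 - Z t) + 4 * a * of_real \<beta> * X t ^ 2 * (1 / Z t)
          = (2 * of_real \<beta> * of_real \<kappa>) ^ 2 * X t ^ 6 / ?u\<^sup>2 - 4 * (of_real \<beta> ^ 2 / of_real \<kappa>) * X t ^ 3 * ?u
            + 2 * a * (2 * of_real \<beta> * of_real \<kappa>) * X t ^ 3 / ?u"
          unfolding ZX using sol_t(1) X0[of t] \<kappa>0
          by (simp add: field_simps power2_eq_square power3_eq_cube eval_nat_numeral)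
        moreover have "complex_of_real \<beta> ^ 2 / of_real \<kappa> = 2 * of_real \<epsilon>"
          using \<kappa>0 unfolding of_real_power[symmetric] \<beta>\<kappa> by simp
        ultimately show ?thesis by (simp add: b\<beta>)
      qed
      finally show ?thesis unfolding X2 .
    qed
    show "((\<lambda>t. E_phi \<epsilon> b a \<nu> l \<phi> (exp t)) has_vector_derivative
        2 * a / 3 + 2 * of_real \<beta> * of_real (exp (2/3 * t)) * (1 / Z t - 1)) (at t)"
    proof -
      define C where "C = - a * of_real (ln ((\<epsilon> * b) powr (1/3) / 4)) + of_real pi - 2 * of_real pi * \<nu> + \<i> * l
        - 2 * \<i> * \<nu> * of_real (ln (2 + sqrt 3))"
      have Eq: "E_phi \<epsilon> b a \<nu> l \<phi> (exp t) =
          \<phi> (exp t) - (of_real (3 * \<beta>) * of_real (exp (2 / 3 * t)) + 2 * a * (2 / 3 * of_real t) + C)" for t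
        by (simp add: E_phi_def C_def \<beta> exp_powr algebra_simps)
      have "((\<lambda>t. E_phi \<epsilon> b a \<nu> l \<phi> (exp t)) has_vector_derivative
          X t ^ 3 * (2 * a / X t ^ 3 + of_real b / ?u) -
          (of_real (3 * \<beta>) * of_real (2 / 3 * exp (2 / 3 * t)) + 2 * a * (2 / 3) + 0)) (at t)"
        unfolding Eq by (intro has_vector_derivative_diff has_vector_derivative_add has_vector_derivative_const d\<phi>)
          (auto intro!: derivative_eq_intros)
      also have "X t ^ 3 * (2 * a / X t ^ 3 + of_real b / ?u) -
          (of_real (3 * \<beta>) * of_real (2 / 3 * exp (2 / 3 * t)) + 2 * a * (2 / 3) + 0)
        = 2 * a / 3 + 2 * of_real \<beta> * X t ^ 2 * (1 / Z t - 1)"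
        unfolding of_real_mult X2 ZX b\<beta> using sol_t(1) X0[of t] \<kappa>0
        by (simp add: field_simps power2_eq_square power3_eq_cube)
      finally show ?thesis unfolding X2 .
    qed
  qed
qed

section \<open>Identification of the leading term and return to the variable
  \<open>\<tau>\<close>\<close>

theorem propositionC1:
  fixes \<epsilon> b T :: real
    and a g11 g12 g21 g22 \<nu> s z l L :: complex
    and u \<phi> :: "real \<Rightarrow> complex"
  assumes eps: "\<epsilon> = 1 \<or> \<epsilon> = -1"
    and b: "\<epsilon> * b > 0"
    and T: "T \<ge> 0"
    and sol: "dp3_solution \<epsilon> b a T u \<phi>"
    and det: "g11 * g22 - g12 * g21 = 1"
    and nz: "g11 * g12 * g21 * g22 \<noteq> 0"
    and nu: "\<nu> = \<i> / (2 * of_real pi) * Ln (g11 * g22)"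
    and Re_nu: "\<bar>Re \<nu>\<bar> < 1/6"
    and s: "s\<^sup>2 = \<nu>"
    and L: "exp L = g11 * g12 * s * Gamma \<nu>"
    and z: "z = of_real (ln (2 * pi)) / 2 + of_real pi * \<i> / 2 - 3 * of_real pi * \<i> / 2 * \<nu>
                + \<i> * a * of_real (ln (2 + sqrt 3)) + \<nu> * of_real (ln 12) - L"
    and l: "exp l = g11\<^sup>2"
    and u_asym: "u_asymptotics \<epsilon> b \<nu> s z u"
    and phi_asym: "\<exists>\<delta>>0. E_phi \<epsilon> b a \<nu> l \<phi> \<in> o[at_top](\<lambda>\<tau>. complex_of_real (\<tau> powr (-\<delta>)))"
    and u_expansion: "u_complete_expansion \<epsilon> b \<nu> s z u"
  shows "\<exists>e1 e2 e3.
      e1 \<in> O[at_top](\<lambda>\<tau>. exp (2 * \<i> * of_real (theta \<epsilon> b \<tau>))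
                              / of_real (\<tau> powr (2/3 * (1 - 2 * \<bar>Re \<nu>\<bar>)))) \<and>
      e2 \<in> O[at_top](\<lambda>\<tau>. exp (- 2 * \<i> * of_real (theta \<epsilon> b \<tau>))
                              / of_real (\<tau> powr (2/3 * (1 - 2 * \<bar>Re \<nu>\<bar>)))) \<and>
      e3 \<in> O[at_top](\<lambda>\<tau>. 1 / complex_of_real (\<tau> powr (2/3))) \<and>
      (\<forall>\<^sub>F \<tau> in at_top.
         E_phi \<epsilon> b a \<nu> l \<phi> \<tau> =
           2 * s * exp (- (3 * pi * \<i> / 4))
             / of_real (3 powr (3/4) * (\<epsilon> * b) powr (1/6) * \<tau> powr (1/3))
             * sinh (\<i> * of_real (theta \<epsilon> b \<tau>) + \<nu> * of_real (ln (theta \<epsilon> b \<tau>)) + z)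
           + e1 \<tau> + e2 \<tau> + e3 \<tau>)"
proof -
  define \<beta> where "\<beta> = (\<epsilon> * b) powr (1/3)"
  define \<omega> where "\<omega> = 3 * sqrt 3 * \<beta>"
  define c where "c = (1 - 2 * \<bar>Re \<nu>\<bar>) / 3"
  define K where "K = s * exp (3 * pi * \<i> / 4) / of_real (3 powr (1/4) * (\<epsilon> * b) powr (1/6))"
  define \<zeta> where "\<zeta> = \<nu> * of_real (ln (3 powr (3/2) * (\<epsilon> * b) powr (1/3))) + z"
  define AB where "AB \<sigma> = K * exp (of_int \<sigma> * \<zeta>)" for \<sigma> :: int
  define Z where "Z t = u (exp t) / of_real (u_lead \<epsilon> b (exp t))" for t
  \<comment> \<open>From here on \<open>L\<close> is the leading term as a function of
    \<open>t\<close> and shadows the logarithm entering \<open>z\<close>.\<close>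
  define L where "L t = \<i> / of_real (sqrt 3) * (AB 1 * mon \<omega> \<nu> 1 1 t - AB (-1) * mon \<omega> \<nu> 1 (-1) t)" for t
  define lead where "lead \<tau> = 2 * s * exp (- (3 * pi * \<i> / 4))
             / of_real (3 powr (3/4) * (\<epsilon> * b) powr (1/6) * \<tau> powr (1/3))
             * sinh (\<i> * of_real (theta \<epsilon> b \<tau>) + \<nu> * of_real (ln (theta \<epsilon> b \<tau>)) + z)" for \<tau>
  have \<beta>0: "\<beta> > 0" unfolding \<beta>_def powr_gt_zero using b by auto
  obtain coeff where coeff: "exp_bigo (- 3 * c) (\<lambda>t. Z t - 1
       - (AB 1 * mon \<omega> \<nu> 1 1 t + AB (-1) * mon \<omega> \<nu> 1 (-1) t)
       - (\<Sum>j=-2..2. coeff j * mon \<omega> \<nu> 2 j t))"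
    unfolding Z_def
    by (rule expansion_at_exp[OF u_expansion \<omega>_def[unfolded \<beta>_def] Re_nu c_def AB_def[unfolded K_def \<zeta>_def]])
  obtain t1 p1 where deriv: "\<And>t. t \<ge> t1 \<Longrightarrow> (Z has_vector_derivative p1 t * Z t) (at t)"
    "\<And>t. t \<ge> t1 \<Longrightarrow> (p1 has_vector_derivative
        4 * of_real \<beta> ^ 2 * of_real (exp (2/3 * t)) ^ 2 * ((1 / Z t) ^ 2 - Z t)
        + 4 * a * of_real \<beta> * of_real (exp (2/3 * t)) * (1 / Z t)) (at t)"
    "\<And>t. t \<ge> t1 \<Longrightarrow> ((\<lambda>t. E_phi \<epsilon> b a \<nu> l \<phi> (exp t)) has_vector_derivative
        2 * a / 3 + 2 * of_real \<beta> * of_real (exp (2/3 * t)) * (1 / Z t - 1)) (at t)"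
    using dp3_solution_log_time[OF eps b T sol \<beta>_def Z_def] by blast
  have E_lim: "((\<lambda>t. E_phi \<epsilon> b a \<nu> l \<phi> (exp t)) \<longlongrightarrow> 0) at_top"
  proof -
    obtain \<delta> where \<delta>: "\<delta> > 0" "E_phi \<epsilon> b a \<nu> l \<phi> \<in> o[at_top](\<lambda>\<tau>. complex_of_real (\<tau> powr (-\<delta>)))"
      using phi_asym by blast
    have "(\<lambda>t. E_phi \<epsilon> b a \<nu> l \<phi> (exp t)) \<in> o[at_top](\<lambda>t. complex_of_real (exp t powr (-\<delta>)))"
      by (rule landau_o.small.compose[OF \<delta>(2) exp_at_top])
    then have "exp_bigo (- \<delta>) (\<lambda>t. E_phi \<epsilon> b a \<nu> l \<phi> (exp t))"
      unfolding exp_powr by (rule landau_o.small_imp_big)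
    then show ?thesis by (rule exp_bigo_tendsto_0) (use \<delta>(1) in simp)
  qed
  have main: "exp_bigo (- 2 * c) (\<lambda>t. E_phi \<epsilon> b a \<nu> l \<phi> (exp t) - L t)"
    unfolding L_def
    by (rule phase_asymptotics[OF \<beta>0 Re_nu c_def \<omega>_def refl refl coeff deriv E_lim])
  \<comment> \<open>By \<open>ln \<theta> = ln \<theta>0 + 2/3 * t\<close>, the argument
    \<open>y\<close> of the hyperbolic sine is \<open>\<zeta>\<close> plus the exponent of
    \<open>w\<close>. The two monomials thus become \<open>exp y\<close> and
    \<open>exp (- y)\<close>, and their difference is \<open>2 * sinh y\<close>.\<close>
  have lead_exp: "lead (exp t) = L t" for t
  proof -
    define \<theta>0 where "\<theta>0 = 3 powr (3/2) * (\<epsilon> * b) powr (1/3)"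
    have \<theta>0: "\<theta>0 > 0" using \<beta>0 by (simp add: \<theta>0_def \<beta>_def)
    have ln: "ln (theta \<epsilon> b (exp t)) = ln \<theta>0 + 2 / 3 * t"
      using \<theta>0 by (simp add: theta_def \<theta>0_def[symmetric] exp_powr ln_mult)
    have th: "theta \<epsilon> b (exp t) = \<omega> * exp (2 / 3 * t)"
      by (simp add: theta_exp \<omega>_def \<beta>_def)
    define y where "y = \<i> * of_real (theta \<epsilon> b (exp t)) + \<nu> * of_real (ln (theta \<epsilon> b (exp t))) + z"
    have y: "y = \<zeta> + (2 / 3 * \<nu> * of_real t + \<i> * of_real \<omega> * of_real (exp (2 / 3 * t)))"
      unfolding y_def ln unfolding th \<zeta>_def \<theta>0_def[symmetric] by (simp add: algebra_simps)
    have AB1: "AB 1 * mon \<omega> \<nu> 1 1 t = K * of_real (exp (- t / 3)) * exp y"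
      unfolding AB_def mon_def y exp_of_real[symmetric]
      by (simp add: mult.assoc mult_exp_exp add_ac)
    have AB2: "AB (-1) * mon \<omega> \<nu> 1 (-1) t = K * of_real (exp (- t / 3)) * exp (- y)"
      unfolding AB_def mon_def y exp_of_real[symmetric]
      by (simp add: mult.assoc mult_exp_exp algebra_simps)
    have "2 * sinh y = exp y - exp (- y)" by (simp add: sinh_field_def)
    then have "L t = \<i> / of_real (sqrt 3) * (K * of_real (exp (- t / 3)) * (2 * sinh y))"
      unfolding L_def AB1 AB2 by (simp only: right_diff_distrib)
    also have "\<dots> = 2 * s * (\<i> * exp (3 * pi * \<i> / 4))
        / of_real (sqrt 3 * 3 powr (1/4) * (\<epsilon> * b) powr (1/6) * exp (t / 3)) * sinh y"
      by (simp add: K_def exp_minus field_simps)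
    \<comment> \<open>The factor \<open>i / sqrt 3\<close> turns the constants of \<open>u\<close>
      into those of the phase: \<open>i\<close> rotates \<open>3 pi / 4\<close> to
      \<open>5 pi / 4\<close>, which is \<open>- 3 pi / 4\<close> modulo \<open>2 pi\<close>, and
      \<open>sqrt 3\<close> raises \<open>3^(1/4)\<close> to \<open>3^(3/4)\<close>.\<close>
    also have "\<i> * exp (3 * pi * \<i> / 4) = exp (- (3 * pi * \<i> / 4))"
    proof -
      have "exp (pi * \<i> / 2) = \<i>"
        using cis_pi_half by (simp add: cis_conv_exp mult.commute)
      then have "\<i> * exp (3 * pi * \<i> / 4) = exp (pi * \<i> / 2 + 3 * pi * \<i> / 4)"
        by (simp only: exp_add)
      also have "pi * \<i> / 2 + 3 * pi * \<i> / 4 = - (3 * pi * \<i> / 4) + 2 * of_real pi * \<i>"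
        by (simp add: field_simps)
      also have "exp \<dots> = exp (- (3 * pi * \<i> / 4))"
        unfolding exp_add exp_two_pi_i by simp
      finally show ?thesis .
    qed
    also have "sqrt 3 * 3 powr (1/4) = 3 powr (3/4)"
    proof -
      have "sqrt 3 * 3 powr (1/4) = 3 powr (1/2) * 3 powr (1/4)" by (simp add: powr_half_sqrt)
      then show ?thesis unfolding powr_add[symmetric] by simp
    qed
    finally show ?thesis by (simp add: lead_def y_def exp_powr)
  qed
  \<comment> \<open>The whole error goes into \<open>e1\<close>, with \<open>e2 = e3 = 0\<close>:
    for real \<theta> the factor \<open>exp (2 * i * \<theta>)\<close> has modulus 1, and
    \<open>2 * c\<close> is the exponent \<open>2/3 * (1 - 2 * |Re \<nu>|)\<close>.\<close>
  define e1 where "e1 \<tau> = E_phi \<epsilon> b a \<nu> l \<phi> \<tau> - lead \<tau>" for \<tau>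
  have "e1 \<in> O[at_top](\<lambda>\<tau>. exp (2 * \<i> * of_real (theta \<epsilon> b \<tau>))
      / of_real (\<tau> powr (2/3 * (1 - 2 * \<bar>Re \<nu>\<bar>))))"
  proof -
    have "(\<lambda>\<tau>. E_phi \<epsilon> b a \<nu> l \<phi> (exp (ln \<tau>)) - L (ln \<tau>)) \<in> O[at_top](\<lambda>\<tau>. complex_of_real (exp (- 2 * c * ln \<tau>)))"
      by (rule landau_o.big.compose[OF main ln_at_top])
    also have "(\<lambda>\<tau>. complex_of_real (exp (- 2 * c * ln \<tau>))) \<in>
        O[at_top](\<lambda>\<tau>. exp (2 * \<i> * of_real (theta \<epsilon> b \<tau>)) / of_real (\<tau> powr (2/3 * (1 - 2 * \<bar>Re \<nu>\<bar>))))"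
    proof (intro bigoI[of _ 1] eventually_mono[OF eventually_gt_at_top[of 0]])
      fix \<tau> :: real assume "\<tau> > 0"
      then have "exp (- 2 * c * ln \<tau>) = 1 / \<tau> powr (2/3 * (1 - 2 * \<bar>Re \<nu>\<bar>))"
        unfolding powr_minus_divide[symmetric] by (simp add: powr_def c_def field_simps)
      then show "cmod (complex_of_real (exp (- 2 * c * ln \<tau>))) \<le>
          1 * cmod (exp (2 * \<i> * of_real (theta \<epsilon> b \<tau>)) / of_real (\<tau> powr (2/3 * (1 - 2 * \<bar>Re \<nu>\<bar>))))"
        by (simp add: norm_divide)
    qed
    finally show ?thesis
    proof (rule landau_o.big.in_cong[THEN iffD1, rotated])
      show "\<forall>\<^sub>F \<tau> in at_top. E_phi \<epsilon> b a \<nu> l \<phi> (exp (ln \<tau>)) - L (ln \<tau>) = e1 \<tau>"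
        by (intro eventually_mono[OF eventually_gt_at_top[of 0]])
          (simp add: e1_def lead_exp[symmetric])
    qed
  qed
  then show ?thesis
    by (intro exI[of _ e1] exI[of _ "\<lambda>_. 0"]) (simp add: e1_def lead_def)
qed

end
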